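(* Consider the Gaussian side-channel assisted three-node full-duplex network described in the context, and let $\mathcal R_{\rm BC}$ be the bin-and-cancel region defined in the context. Then for all values of $\mathrm{SNR}_1,\mathrm{SNR}_2,\mathrm{INR},\mathrm{SNR}_{\rm side}$ and all bandwidth ratios $W\in[0,W_{\max}]$, $\mathcal R_{\rm BC}$ is within 1 bit/s/Hz of the capacity region $\mathcal C$: for every $(R_1,R_2)\in\mathcal C$, the pair $\big(R_1-(W_m+W_s),\,R_2-(W_m+W_s)\big)$ belongs to $\mathcal R_{\rm BC}$.
   Context: Gaussian side-channel assisted three-node full-duplex network: a full-duplex base station (BS) sends a downlink message $S_1$ at rate $R_1$ to a half-duplex mobile M2, while a half-duplex mobile M1 sends an uplink message $S_2$ at rate $R_2$ to BS. The main channel has bandwidth $W_m$; an orthogonal wireless side-channel from M1 to M2 has bandwidth $W_s$, and $W=W_s/W_m\in[0,W_{\max}]$. The real-valued input–output relations are $Y_1=\gamma_1X_1+\gamma^m_{21}X_2+Z_1$ (received by M2), $Y_2=\gamma_2X_2+Z_2$ (received by BS), $Y_3=\gamma^s_{21}X_3+Z_3$ (received by M2 on the side-channel), where $X_1$ is sent by BS, $X_2,X_3$ by M1, and $Z_i$ are mutually independent i.i.d. $\mathcal N(0,\sigma^2)$. Power constraints: $\mathbb E|X_1|^2\le P_1$, $\mathbb E|X_2+X_3|^2\le P_2$. $\mathrm{SNR}_1=|\gamma_1|^2P_1/\sigma^2$, $\mathrm{SNR}_2=|\gamma_2|^2P_2/\sigma^2$, $\mathrm{INR}=|\gamma^m_{21}|^2P_2/\sigma^2$,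 $\mathrm{SNR}_{\rm side}=|\gamma^s_{21}|^2P_2/\sigma^2$. Rates in bits/s, $C(x)=W_m\log_2(1+x)$, $W\,C(x/W)=W_s\log_2(1+x/W)$, with $W\,C(x/W)=0$ if $W=0$. M2 decodes $S_1$ from $(Y_1^n,Y_3^n)$; BS decodes $S_2$ from $Y_2^n$ and $S_1$; BS's symbol at time $i$ may depend on $(S_1,Y_2^{i-1})$. The capacity region $\mathcal C$ is the closure of the set of achievable rate pairs. Gaps in bits/s/Hz are normalized by the total bandwidth $W_m+W_s$. Write $\bar\beta=1-\beta$, $\bar\lambda=1-\lambda$. The bin-and-cancel region $\mathcal R_{\rm BC}$ is: (a) if $\mathrm{INR}\le\mathrm{SNR}_2$, the union over $\beta,\lambda\in[0,1]$ of the sets of $(R_1,R_2)$ with $R_1\le C\big(\mathrm{SNR}_1/(1+\beta\bar\lambda\mathrm{INR})\big)$, $R_2\le\min\{C(\bar\lambda\mathrm{SNR}_2),\,C(\beta\bar\lambda\mathrm{SNR}_2)+C\big(\bar\beta\bar\lambda\mathrm{INR}/(1+\beta\bar\lambda\mathrm{INR})\big)+W C(\lambda\mathrm{SNR}_{\rm side}/W)\}$, $R_1+R_2\le C(\beta\bar\lambda\mathrm{SNR}_2)+C\big((\mathrm{SNR}_1+\bar\beta\bar\lambda\mathrm{INR})/(1+\beta\bar\lambda\mathrm{INR})\big)+W C(\lambda\mathrm{SNR}_{\rm side}/W)$; (b) if $\mathrm{SNR}_2\le\mathrm{INR}\le\mathrm{SNR}_2(1+\mathrm{SNR}_1)$,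 the union over $\lambda\in[0,1]$ of the sets with $R_1\le C(\mathrm{SNR}_1)$, $R_2\le C(\bar\lambda\mathrm{SNR}_2)$, $R_1+R_2\le C(\mathrm{SNR}_1+\bar\lambda\mathrm{INR})+W C(\lambda\mathrm{SNR}_{\rm side}/W)$; (c) if $\mathrm{INR}\ge\mathrm{SNR}_2(1+\mathrm{SNR}_1)$, the set $R_1\le C(\mathrm{SNR}_1)$, $R_2\le C(\mathrm{SNR}_2)$. *)

theory Defs
  imports "HOL-Probability.Probability"
begin

text \<open>Discrete-time (sampled) model.  A block of T seconds consists of n = 2 W_m T real
  samples of the main channel and k = 2 W_s T real samples of the side channel, so
  k / n = W.  A rate R in bits/s corresponds to log2 M = R T = n R / (2 W_m).
  Powers P1, P2 are energy budgets per main-channel sample, so that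
  SNR = gamma^2 P / sigma^2 as in the paper; noise samples are i.i.d. N(0, sigma^2)
  (sigma is the standard deviation).\<close>

definition gauss :: "real \<Rightarrow> real measure" where
  "gauss \<sigma> = density lborel (normal_density 0 \<sigma>)"

definition noiseM :: "real \<Rightarrow> nat \<Rightarrow> nat \<Rightarrow> ((nat \<Rightarrow> real) \<times> (nat \<Rightarrow> real) \<times> (nat \<Rightarrow> real)) measure" where
  "noiseM \<sigma> n k = pair_measure (PiM {..<n} (\<lambda>_. gauss \<sigma>))
      (pair_measure (PiM {..<n} (\<lambda>_. gauss \<sigma>)) (PiM {..<k} (\<lambda>_. gauss \<sigma>)))"

definition sigY2 :: "real \<Rightarrow> nat \<Rightarrow> (nat \<Rightarrow> real) \<Rightarrow> (nat \<Rightarrow> real) \<Rightarrow> (nat \<Rightarrow> real)" where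
  "sigY2 \<gamma>2 n x2 z2 = restrict (\<lambda>i. \<gamma>2 * x2 i + z2 i) {..<n}"

text \<open>BS transmit symbol at time i: f1 S1 i Y2 (causal in Y2, see code_ok).\<close>
definition sigX1 :: "(nat \<Rightarrow> nat \<Rightarrow> (nat \<Rightarrow> real) \<Rightarrow> real) \<Rightarrow> nat \<Rightarrow> real \<Rightarrow> nat
     \<Rightarrow> (nat \<Rightarrow> real) \<Rightarrow> (nat \<Rightarrow> real) \<Rightarrow> (nat \<Rightarrow> real)" where
  "sigX1 f1 s1 \<gamma>2 n x2 z2 = restrict (\<lambda>i. f1 s1 i (sigY2 \<gamma>2 n x2 z2)) {..<n}"

definition sigY1 :: "real \<Rightarrow> real \<Rightarrow> real \<Rightarrow> (nat \<Rightarrow> nat \<Rightarrow> (nat \<Rightarrow> real) \<Rightarrow> real) \<Rightarrow> nat \<Rightarrow> nat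
     \<Rightarrow> (nat \<Rightarrow> real) \<Rightarrow> (nat \<Rightarrow> real) \<Rightarrow> (nat \<Rightarrow> real) \<Rightarrow> (nat \<Rightarrow> real)" where
  "sigY1 \<gamma>1 \<gamma>m \<gamma>2 f1 s1 n x2 z1 z2 =
     restrict (\<lambda>i. \<gamma>1 * sigX1 f1 s1 \<gamma>2 n x2 z2 i + \<gamma>m * x2 i + z1 i) {..<n}"

definition sigY3 :: "real \<Rightarrow> nat \<Rightarrow> (nat \<Rightarrow> real) \<Rightarrow> (nat \<Rightarrow> real) \<Rightarrow> (nat \<Rightarrow> real)" where
  "sigY3 \<gamma>s k x3 z3 = restrict (\<lambda>j. \<gamma>s * x3 j + z3 j) {..<k}"

text \<open>A code with n main-channel uses, k side-channel uses, message sets {..<M1}, {..<M2},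
  BS encoder f1 (symbol at time i depends on S1 and Y2 at times < i), M1 encoders g2, g3
  (half-duplex, depend on S2 only), decoder d2 at M2 (from Y1^n, Y3^k), decoder d1 at BS
  (from S1 and Y2^n), satisfying the (expected) power constraints and having average
  error probability at most eps.\<close>
definition code_ok ::
  "real \<Rightarrow> real \<Rightarrow> real \<Rightarrow> real \<Rightarrow> real \<Rightarrow> real \<Rightarrow> real \<Rightarrow> nat \<Rightarrow> nat \<Rightarrow> nat \<Rightarrow> nat
   \<Rightarrow> (nat \<Rightarrow> nat \<Rightarrow> (nat \<Rightarrow> real) \<Rightarrow> real) \<Rightarrow> (nat \<Rightarrow> nat \<Rightarrow> real) \<Rightarrow> (nat \<Rightarrow> nat \<Rightarrow> real)
   \<Rightarrow> ((nat \<Rightarrow> real) \<Rightarrow> (nat \<Rightarrow> real) \<Rightarrow> nat) \<Rightarrow> (nat \<Rightarrow> (nat \<Rightarrow> real) \<Rightarrow> nat) \<Rightarrow> real \<Rightarrow> bool" where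
  "code_ok \<gamma>1 \<gamma>m \<gamma>s \<gamma>2 \<sigma> P1 P2 n k M1 M2 f1 g2 g3 d2 d1 \<epsilon> \<longleftrightarrow>
     M1 \<ge> 1 \<and> M2 \<ge> 1 \<and>
     (\<forall>s i y y'. (\<forall>j<i. y j = y' j) \<longrightarrow> f1 s i y = f1 s i y') \<and>
     (\<forall>s i. f1 s i \<in> borel_measurable (PiM {..<n} (\<lambda>_. borel))) \<and>
     (\<forall>s. d1 s \<in> measurable (PiM {..<n} (\<lambda>_. borel)) (count_space UNIV)) \<and>
     (\<lambda>(a, b). d2 a b) \<in> measurable
        (pair_measure (PiM {..<n} (\<lambda>_. borel)) (PiM {..<k} (\<lambda>_. borel))) (count_space UNIV) \<and>
     (\<Sum>s1<M1. \<Sum>s2<M2. nn_integral (noiseM \<sigma> n k)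
        (\<lambda>(z1, z2, z3). ennreal (\<Sum>i<n. (sigX1 f1 s1 \<gamma>2 n (g2 s2) z2 i)\<^sup>2)))
       \<le> ennreal (real M1 * real M2 * real n * P1) \<and>
     (\<Sum>s2<M2. (\<Sum>i<n. (g2 s2 i)\<^sup>2) + (\<Sum>j<k. (g3 s2 j)\<^sup>2)) \<le> real M2 * real n * P2 \<and>
     (\<Sum>s1<M1. \<Sum>s2<M2. measure (noiseM \<sigma> n k)
        {(z1, z2, z3) \<in> space (noiseM \<sigma> n k).
           d2 (sigY1 \<gamma>1 \<gamma>m \<gamma>2 f1 s1 n (g2 s2) z1 z2) (sigY3 \<gamma>s k (g3 s2) z3) \<noteq> s1 \<or>
           d1 s1 (sigY2 \<gamma>2 n (g2 s2) z2) \<noteq> s2})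
       \<le> \<epsilon> * real M1 * real M2"

definition achievable ::
  "real \<Rightarrow> real \<Rightarrow> real \<Rightarrow> real \<Rightarrow> real \<Rightarrow> real \<Rightarrow> real \<Rightarrow> real \<Rightarrow> real \<Rightarrow> real \<Rightarrow> real \<Rightarrow> bool" where
  "achievable \<gamma>1 \<gamma>m \<gamma>s \<gamma>2 \<sigma> P1 P2 Wm W R1 R2 \<longleftrightarrow>
     R1 \<ge> 0 \<and> R2 \<ge> 0 \<and>
     (\<forall>\<epsilon>>0. \<forall>N. \<exists>n k M1 M2 f1 g2 g3 d2 d1.
        n \<ge> N \<and> real k \<le> W * real n \<and>
        2 * Wm * log 2 (real M1) \<ge> real n * (R1 - \<epsilon>) \<and>
        2 * Wm * log 2 (real M2) \<ge> real n * (R2 - \<epsilon>) \<and>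
        code_ok \<gamma>1 \<gamma>m \<gamma>s \<gamma>2 \<sigma> P1 P2 n k M1 M2 f1 g2 g3 d2 d1 \<epsilon>)"

definition capacity_region ::
  "real \<Rightarrow> real \<Rightarrow> real \<Rightarrow> real \<Rightarrow> real \<Rightarrow> real \<Rightarrow> real \<Rightarrow> real \<Rightarrow> real \<Rightarrow> (real \<times> real) set" where
  "capacity_region \<gamma>1 \<gamma>m \<gamma>s \<gamma>2 \<sigma> P1 P2 Wm W =
     closure {(R1, R2). achievable \<gamma>1 \<gamma>m \<gamma>s \<gamma>2 \<sigma> P1 P2 Wm W R1 R2}"

definition Cap :: "real \<Rightarrow> real \<Rightarrow> real" where
  "Cap Wm x = Wm * log 2 (1 + x)"

definition WCap :: "real \<Rightarrow> real \<Rightarrow> real \<Rightarrow> real" where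
  "WCap Wm W x = (if W = 0 then 0 else W * Cap Wm (x / W))"

definition R_BC :: "real \<Rightarrow> real \<Rightarrow> real \<Rightarrow> real \<Rightarrow> real \<Rightarrow> real \<Rightarrow> (real \<times> real) set" where
  "R_BC Wm W snr1 snr2 inr snrs =
    (if inr \<le> snr2 then
       (\<Union>bet\<in>{0..1}. \<Union>lam\<in>{0..1}. {(R1, R2).
          R1 \<le> Cap Wm (snr1 / (1 + bet * (1 - lam) * inr)) \<and>
          R2 \<le> min (Cap Wm ((1 - lam) * snr2))
                   (Cap Wm (bet * (1 - lam) * snr2)
                    + Cap Wm ((1 - bet) * (1 - lam) * inr / (1 + bet * (1 - lam) * inr))
                    + WCap Wm W (lam * snrs)) \<and>
          R1 + R2 \<le> Cap Wm (bet * (1 - lam) * snr2)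
                    + Cap Wm ((snr1 + (1 - bet) * (1 - lam) * inr) / (1 + bet * (1 - lam) * inr))
                    + WCap Wm W (lam * snrs)})
     else if inr \<le> snr2 * (1 + snr1) then
       (\<Union>lam\<in>{0..1}. {(R1, R2).
          R1 \<le> Cap Wm snr1 \<and>
          R2 \<le> Cap Wm ((1 - lam) * snr2) \<and>
          R1 + R2 \<le> Cap Wm (snr1 + (1 - lam) * inr) + WCap Wm W (lam * snrs)})
     else {(R1, R2). R1 \<le> Cap Wm snr1 \<and> R2 \<le> Cap Wm snr2})"

end

theory Submission
  imports Defs
begin

text \<open>The converse is a change of measure. If \<open>L\<close> is the log likelihood ratio between the true law
  and a reference law under which the decoders succeed with probability at most \<open>1 / m\<close>, then a
  success probability \<open>1 - \<epsilon>\<close> forces \<open>(1 - \<epsilon>) ln m \<le> E L + ln 2\<close>. All reference laws are Gaussian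
  products, so \<open>E L\<close> is a quadratic expectation and no differential entropy is needed. For the
  individual rates the reference replaces \<open>Y1\<close> (given \<open>S2\<close> and the other noises) or \<open>Y2\<close> by white
  Gaussian noise of the same power. For the sum rate it makes \<open>Y1\<close> and \<open>Y3\<close> independent white
  noises and draws \<open>Y2\<close> causally, around the linear estimate of \<open>\<gamma>2 X2\<close> from \<open>Y1 - \<gamma>1 X1\<close>; this
  involves \<open>S1\<close> but not \<open>S2\<close>, which is what gives the term \<open>C(SNR2 / (1 + INR))\<close> in spite of the
  feedback from \<open>Y2\<close> to \<open>X1\<close>. The power split \<open>\<lambda>\<close> is read off the code, and the limit over codes is
  taken by compactness of \<open>[0, 1]\<close>. The outer bound is then compared with the inner region at
  \<open>\<beta> = min 1 (1 / ((1 - \<lambda>) INR))\<close>, where the residual interference reaches the noise level at most.\<close>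

section \<open>Products of Gaussian and Lebesgue measures\<close>

text \<open>The obstacle is the feedback: X1 depends on \<open>S1\<close> and on the past of Y2, so
  X1 and X2 are correlated and the cross term in the power of Y1 need not vanish. It is absorbed by
  (x + y)^2 <= 2 x^2 + 2 y^2, at the price of one bit. Estimating from Y1 - \<gamma>1 X1 keeps the
  correlation out of the other terms, because X1 cancels in the residual. The bits are counted as
  follows. Each rate may lose \<open>Wm\<close>, so the sum may lose 2 \<open>Wm\<close>. One bit of
  the sum pays for the doubling. The other pays for the residual interference when INR <= SNR2, and
  for the term C(SNR2 / (1 + INR)), which is then at most \<open>Wm\<close>, when INR is larger but
  not above SNR2 (1 + SNR1). Powers are constrained only on average over the messages. This suffices
  because E L is affine in the second moments, which is why all estimates are summed over the
  message pairs before they are bounded. The additive ln 2 disappears after division by the block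
  length.\<close>

lemma PiM_lborel_translation:
  fixes t :: "'i \<Rightarrow> real"
  assumes "finite I"
  shows "distr (PiM I (\<lambda>_. lborel)) (PiM I (\<lambda>_. lborel)) (\<lambda>z. \<lambda>i\<in>I. t i + z i)
    = PiM I (\<lambda>_. lborel)" (is "distr ?P ?P ?f = _")
proof -
  interpret product_sigma_finite "\<lambda>_::'i. lborel :: real measure" ..
  show ?thesis
  proof (rule PiM_eqI)
    fix A :: "'i \<Rightarrow> real set"
    assume A: "\<And>i. i \<in> I \<Longrightarrow> A i \<in> sets lborel"
    have vim: "?f -` Pi\<^sub>E I A \<inter> space ?P = Pi\<^sub>E I (\<lambda>i. (+) (t i) -` A i)"
      by (auto simp: space_PiM PiE_iff)
    have m: "(+) (t i) -` A i \<in> sets borel" if "i \<in> I" for i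
      using measurable_sets[of "(+) (t i)" borel borel "A i"] A[OF that] by simp
    have tr: "emeasure lborel ((+) (t i) -` A i) = emeasure lborel (A i)" if "i \<in> I" for i
    proof -
      have "emeasure (distr lborel borel ((+) (t i))) (A i) = emeasure lborel ((+) (t i) -` A i)"
        using A[OF that] by (subst emeasure_distr) auto
      then show ?thesis by (simp add: lborel_distr_plus)
    qed
    have "emeasure (distr ?P ?P ?f) (Pi\<^sub>E I A) = emeasure ?P (?f -` Pi\<^sub>E I A \<inter> space ?P)"
      using A assms by (intro emeasure_distr) (auto intro!: sets_PiM_I_finite)
    also have "\<dots> = (\<Prod>i\<in>I. emeasure lborel (A i))"
      unfolding vim using assms m by (subst emeasure_PiM) (auto intro!: prod.cong tr)
    finally show "emeasure (distr ?P ?P ?f) (Pi\<^sub>E I A) = (\<Prod>i\<in>I. emeasure lborel (A i))" .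
  qed (use assms in auto)
qed

lemma nn_integral_PiM_lborel_translate:
  fixes t :: "'i \<Rightarrow> real"
  assumes "finite I" and [measurable]: "H \<in> borel_measurable (PiM I (\<lambda>_. lborel))"
  shows "(\<integral>\<^sup>+z. H (\<lambda>i\<in>I. t i + z i) \<partial>PiM I (\<lambda>_. lborel)) = (\<integral>\<^sup>+y. H y \<partial>PiM I (\<lambda>_. lborel))"
  by (subst (2) PiM_lborel_translation[OF assms(1), of t, symmetric])
     (simp add: nn_integral_distr)

text \<open>The two measures agree on boxes, where the integral of a product of one-variable
  functions factors; sigma-finiteness of the factors makes boxes determine the product
  measure.\<close>

lemma PiM_density:
  fixes f :: "'i \<Rightarrow> real \<Rightarrow> ennreal"
  assumes "finite I" and [measurable]: "\<And>i. f i \<in> borel_measurable borel"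
    and "\<And>i. sigma_finite_measure (density lborel (f i))"
  shows "PiM I (\<lambda>i. density lborel (f i))
    = density (PiM I (\<lambda>_. lborel)) (\<lambda>z. \<Prod>i\<in>I. f i (z i))" (is "_ = ?D")
proof -
  interpret L: product_sigma_finite "\<lambda>_::'i. lborel :: real measure" ..
  interpret product_sigma_finite "\<lambda>i. density lborel (f i)"
    using assms(3) by (simp add: product_sigma_finite_def)
  have "?D = PiM I (\<lambda>i. density lborel (f i))"
  proof (rule PiM_eqI)
    fix A :: "'i \<Rightarrow> real set"
    assume A: "\<And>i. i \<in> I \<Longrightarrow> A i \<in> sets (density lborel (f i))"
    have [measurable]: "Pi\<^sub>E I A \<in> sets (PiM I (\<lambda>_. lborel))"
      using A assms by (auto intro!: sets_PiM_I_finite)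
    have "emeasure ?D (Pi\<^sub>E I A)
        = (\<integral>\<^sup>+z. (\<Prod>i\<in>I. f i (z i)) * indicator (Pi\<^sub>E I A) z \<partial>PiM I (\<lambda>_. lborel))"
      by (subst emeasure_density) auto
    also have "\<dots> = (\<integral>\<^sup>+z. (\<Prod>i\<in>I. f i (z i) * indicator (A i) (z i)) \<partial>PiM I (\<lambda>_. lborel))"
      using assms(1) by (intro nn_integral_cong)
        (auto simp: prod.distrib space_PiM PiE_iff indicator_def prod_zero_iff)
    also have "\<dots> = (\<Prod>i\<in>I. \<integral>\<^sup>+x. f i x * indicator (A i) x \<partial>lborel)"
      using A assms(1) by (intro L.product_nn_integral_prod) auto
    also have "\<dots> = (\<Prod>i\<in>I. emeasure (density lborel (f i)) (A i))"
      using A by (intro prod.cong refl) (subst emeasure_density; auto)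
    finally show "emeasure ?D (Pi\<^sub>E I A) = (\<Prod>i\<in>I. emeasure (density lborel (f i)) (A i))" .
  qed (use assms in \<open>auto intro!: sets_PiM_cong\<close>)
  then show ?thesis by simp
qed

section \<open>White Gaussian noise vectors and their removal by a density\<close>

lemma sets_gauss [simp, measurable_cong]: "sets (gauss \<sigma>) = sets borel"
  by (simp add: gauss_def)

lemma space_gauss [simp]: "space (gauss \<sigma>) = UNIV"
  by (simp add: gauss_def)

lemma prob_space_gauss: "\<sigma> > 0 \<Longrightarrow> prob_space (gauss \<sigma>)"
  unfolding gauss_def by (rule prob_space_normal_density)

abbreviation gaussV :: "real \<Rightarrow> nat \<Rightarrow> (nat \<Rightarrow> real) measure" where
  "gaussV \<sigma> n \<equiv> PiM {..<n} (\<lambda>_. gauss \<sigma>)"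

abbreviation lebV :: "nat \<Rightarrow> (nat \<Rightarrow> real) measure" where
  "lebV n \<equiv> PiM {..<n} (\<lambda>_. lborel)"

lemma prob_space_gaussV: "\<sigma> > 0 \<Longrightarrow> prob_space (gaussV \<sigma> n)"
  by (intro prob_space_PiM prob_space_gauss)

lemma sigma_finite_lebV: "sigma_finite_measure (lebV n)"
proof -
  interpret product_sigma_finite "\<lambda>_::nat. lborel :: real measure" ..
  show ?thesis by (rule sigma_finite) simp
qed

lemma gaussV_density:
  assumes "\<sigma> > 0"
  shows "gaussV \<sigma> n = density (lebV n) (\<lambda>z. \<Prod>i<n. ennreal (normal_density 0 \<sigma> (z i)))"
  unfolding gauss_def using assms prob_space_normal_density[OF assms, of 0]
  by (intro PiM_density) (auto dest: prob_space_imp_sigma_finite)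

text \<open>Dividing by the noise density turns the noise into Lebesgue measure, and translation
  invariance then swallows the signal \<open>t\<close>. This is how a weighted expectation under the
  true law becomes an expectation under a reference that does not know the codeword.\<close>

lemma nn_integral_gaussV_unnormalize:
  assumes "\<sigma> > 0" and [measurable]: "H \<in> borel_measurable (lebV n)"
  shows "(\<integral>\<^sup>+z. H (\<lambda>i\<in>{..<n}. t i + z i) * ennreal (\<Prod>i<n. 1 / normal_density 0 \<sigma> (z i)) \<partial>gaussV \<sigma> n)
    = (\<integral>\<^sup>+y. H y \<partial>lebV n)"
proof -
  have one: "ennreal (\<Prod>i<n. normal_density 0 \<sigma> (z i)) * ennreal (\<Prod>i<n. 1 / normal_density 0 \<sigma> (z i)) = 1"
    for z :: "nat \<Rightarrow> real"
    using normal_density_pos[OF assms(1), of 0]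
    by (subst ennreal_mult[symmetric])
       (auto intro!: prod_nonneg simp: prod.distrib[symmetric] less_imp_neq[symmetric])
  have "(\<integral>\<^sup>+z. H (\<lambda>i\<in>{..<n}. t i + z i) * ennreal (\<Prod>i<n. 1 / normal_density 0 \<sigma> (z i)) \<partial>gaussV \<sigma> n)
    = (\<integral>\<^sup>+z. (\<Prod>i<n. ennreal (normal_density 0 \<sigma> (z i))) *
        (H (\<lambda>i\<in>{..<n}. t i + z i) * ennreal (\<Prod>i<n. 1 / normal_density 0 \<sigma> (z i))) \<partial>lebV n)"
    unfolding gaussV_density[OF assms(1)] by (rule nn_integral_density) measurable
  also have "\<dots> = (\<integral>\<^sup>+z. H (\<lambda>i\<in>{..<n}. t i + z i) \<partial>lebV n)"
    by (intro nn_integral_cong)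
       (simp add: prod_ennreal mult.left_commute[of "ennreal (prod _ _)" "H _"] one)
  also have "\<dots> = (\<integral>\<^sup>+y. H y \<partial>lebV n)"
    by (rule nn_integral_PiM_lborel_translate) auto
  finally show ?thesis .
qed

lemma nn_integral_normal_density:
  assumes "\<tau> > 0"
  shows "(\<integral>\<^sup>+y. ennreal (normal_density \<mu> \<tau> y) \<partial>lborel) = 1"
  using assms by (subst nn_integral_eq_integral) auto

text \<open>Integrating out the last coordinate first leaves a density of the same kind, so
  induction on the length works although every mean depends on earlier coordinates. It normalises
  the reference law of Y2, whose means contain the feedback symbols.\<close>

lemma nn_integral_causal_density:
  fixes h :: "nat \<Rightarrow> (nat \<Rightarrow> real) \<Rightarrow> real"
  assumes "\<tau> > 0"
    and caus: "\<And>i y y'. (\<And>j. j < i \<Longrightarrow> y j = y' j) \<Longrightarrow> h i y = h i y'"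
    and meas: "\<And>i. i < n \<Longrightarrow> h i \<in> borel_measurable (PiM {..<n} (\<lambda>_. borel))"
  shows "(\<integral>\<^sup>+y. (\<Prod>i<n. ennreal (normal_density (h i y) \<tau> (y i))) \<partial>lebV n) = 1"
proof -
  interpret product_sigma_finite "\<lambda>_::nat. lborel :: real measure" ..
  have hm: "h i \<in> borel_measurable (lebV m)" if "i < n" "i \<le> m" for i m
  proof -
    \<comment> \<open>Coordinates from \<open>m\<close> on are replaced by 0, which
      \<open>h i\<close> cannot see; this transfers measurability from length \<open>n\<close> to
      the shorter vectors of the induction.\<close>
    have eq: "h i = (\<lambda>y. h i (\<lambda>j\<in>{..<n}. if j < m then y j else 0))"
      using that by (intro ext caus) auto
    have "(\<lambda>y. \<lambda>j\<in>{..<n}. if j < m then y j else 0) \<in> lebV m \<rightarrow>\<^sub>M PiM {..<n} (\<lambda>_. borel :: real measure)"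
    proof (rule measurable_restrict)
      fix j assume "j \<in> {..<n}"
      then show "(\<lambda>y. if j < m then y j else 0) \<in> lebV m \<rightarrow>\<^sub>M (borel :: real measure)"
        by (cases "j < m") auto
    qed
    from measurable_compose[OF this meas[OF that(1)]] show ?thesis
      by (subst eq)
  qed
  have "(\<integral>\<^sup>+y. (\<Prod>i<m. ennreal (normal_density (h i y) \<tau> (y i))) \<partial>lebV m) = 1" if "m \<le> n" for m
    using that
  proof (induction m)
    case 0
    have "space (PiM {} (\<lambda>_::nat. lborel :: real measure)) = {\<lambda>_. undefined}"
      by (simp add: space_PiM)
    then show ?case by (simp add: PiM_empty)
  next
    case (Suc m)
    have [measurable]: "h i \<in> borel_measurable (lebV (Suc m))" if "i \<in> {..<Suc m}" for i
      using hm[of i "Suc m"] that Suc.prems by auto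
    have ins: "{..<Suc m} = insert m {..<m}" by auto
    have "(\<integral>\<^sup>+y. (\<Prod>i<Suc m. ennreal (normal_density (h i y) \<tau> (y i))) \<partial>lebV (Suc m))
      = (\<integral>\<^sup>+x. \<integral>\<^sup>+y. (\<Prod>i<Suc m. ennreal (normal_density (h i (x(m := y))) \<tau> ((x(m := y)) i))) \<partial>lborel \<partial>lebV m)"
    proof (subst (1) ins, rule product_nn_integral_insert)
      have "(\<lambda>y. \<Prod>i<Suc m. ennreal (normal_density (h i y) \<tau> (y i))) \<in> borel_measurable (lebV (Suc m))"
        unfolding normal_density_def by measurable
      then show "(\<lambda>y. \<Prod>i<Suc m. ennreal (normal_density (h i y) \<tau> (y i)))
          \<in> borel_measurable (Pi\<^sub>M (insert m {..<m}) (\<lambda>_. lborel))"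
        by (simp only: ins)
    qed auto
    also have "\<dots> = (\<integral>\<^sup>+x. \<integral>\<^sup>+y. (\<Prod>i<m. ennreal (normal_density (h i x) \<tau> (x i)))
          * ennreal (normal_density (h m x) \<tau> y) \<partial>lborel \<partial>lebV m)"
    proof (intro nn_integral_cong)
      fix x :: "nat \<Rightarrow> real" and y :: real
      \<comment> \<open>The index \<open>i = m\<close> is included: causality is strict, so even the
        mean of coordinate \<open>m\<close> ignores coordinate \<open>m\<close>, and the inner
        integral is that of one normal density.\<close>
      have "h i (x(m := y)) = h i x" if "i \<le> m" for i
        using that by (intro caus) auto
      then show "(\<Prod>i<Suc m. ennreal (normal_density (h i (x(m := y))) \<tau> ((x(m := y)) i)))
        = (\<Prod>i<m. ennreal (normal_density (h i x) \<tau> (x i))) * ennreal (normal_density (h m x) \<tau> y)"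
        by simp
    qed
    also have "\<dots> = (\<integral>\<^sup>+x. (\<Prod>i<m. ennreal (normal_density (h i x) \<tau> (x i))) \<partial>lebV m)"
      using assms(1) by (simp add: nn_integral_cmult nn_integral_normal_density)
    finally show ?case using Suc by simp
  qed
  then show ?thesis by blast
qed

section \<open>Moments, likelihood ratios and Fano's inequality\<close>

lemma pair_prob_integral_mult:
  fixes f :: "'a \<Rightarrow> real" and g :: "'b \<Rightarrow> real"
  assumes "prob_space M" "prob_space N" "integrable M f" "integrable N g"
  shows "integrable (M \<Otimes>\<^sub>M N) (\<lambda>x. f (fst x) * g (snd x))"
    and "(\<integral>x. f (fst x) * g (snd x) \<partial>(M \<Otimes>\<^sub>M N)) = (\<integral>x. f x \<partial>M) * (\<integral>y. g y \<partial>N)"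
proof -
  interpret M: prob_space M by fact
  interpret N: prob_space N by fact
  interpret pair_sigma_finite M N ..
  have [measurable]: "f \<in> borel_measurable M" "g \<in> borel_measurable N"
    using assms by auto
  show int: "integrable (M \<Otimes>\<^sub>M N) (\<lambda>x. f (fst x) * g (snd x))"
    using assms by (intro Fubini_integrable) (auto simp: abs_mult)
  show "(\<integral>x. f (fst x) * g (snd x) \<partial>(M \<Otimes>\<^sub>M N)) = (\<integral>x. f x \<partial>M) * (\<integral>y. g y \<partial>N)"
    using integral_fst'[OF int] by simp
qed

lemma pair_prob_integral_fst:
  fixes f :: "'a \<Rightarrow> real"
  assumes "prob_space M" "prob_space N" "integrable M f"
  shows "integrable (M \<Otimes>\<^sub>M N) (\<lambda>x. f (fst x))"
    and "(\<integral>x. f (fst x) \<partial>(M \<Otimes>\<^sub>M N)) = (\<integral>x. f x \<partial>M)"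
  using pair_prob_integral_mult[OF assms, of "\<lambda>_. 1"] assms prob_space.prob_space[OF assms(2)]
    prob_space.finite_measure[OF assms(2)]
  by (simp_all add: finite_measure.integrable_const)

lemma pair_prob_integral_snd:
  fixes g :: "'b \<Rightarrow> real"
  assumes "prob_space M" "prob_space N" "integrable N g"
  shows "integrable (M \<Otimes>\<^sub>M N) (\<lambda>x. g (snd x))"
    and "(\<integral>x. g (snd x) \<partial>(M \<Otimes>\<^sub>M N)) = (\<integral>x. g x \<partial>N)"
  using pair_prob_integral_mult[OF assms(1,2) _ assms(3), of "\<lambda>_. 1"] prob_space.prob_space[OF assms(1)]
    prob_space.finite_measure[OF assms(1)]
  by (simp_all add: finite_measure.integrable_const)

lemma gaussV_component_moments:
  assumes "\<sigma> > 0" "i < n"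
  shows "integrable (gaussV \<sigma> n) (\<lambda>z. z i)" "(\<integral>z. z i \<partial>gaussV \<sigma> n) = 0"
    and "integrable (gaussV \<sigma> n) (\<lambda>z. (z i)\<^sup>2)" "(\<integral>z. (z i)\<^sup>2 \<partial>gaussV \<sigma> n) = \<sigma>\<^sup>2"
proof -
  have *: "distr (gaussV \<sigma> n) (gauss \<sigma>) (\<lambda>z. z i) = gauss \<sigma>"
    by (rule distr_PiM_component) (use assms prob_space_gauss in auto)
  have mi: "(\<lambda>z. z i) \<in> gaussV \<sigma> n \<rightarrow>\<^sub>M gauss \<sigma>"
    by (rule measurable_component_singleton) (use assms in auto)
  have tr1: "integrable (gaussV \<sigma> n) (\<lambda>z. f (z i)) \<longleftrightarrow> integrable (gauss \<sigma>) f"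
    if "f \<in> borel_measurable borel" for f :: "real \<Rightarrow> real"
    using integrable_distr_eq[OF mi, of f] that by (simp add: *)
  have tr2: "(\<integral>z. f (z i) \<partial>gaussV \<sigma> n) = (\<integral>x. f x \<partial>gauss \<sigma>)"
    if "f \<in> borel_measurable borel" for f :: "real \<Rightarrow> real"
    using integral_distr[OF mi, of f] that by (simp add: *)
  have g1: "integrable (gauss \<sigma>) (\<lambda>x. x ^ k)" for k :: nat
    unfolding gauss_def using integrable_normal_moment[OF assms(1), of 0 k]
    by (subst integrable_density) auto
  have g2: "(\<integral>x. x ^ k \<partial>gauss \<sigma>) = (\<integral>x. normal_density 0 \<sigma> x * (x - 0) ^ k \<partial>lborel)" for k :: nat
    unfolding gauss_def by (subst integral_density) auto
  have "integrable (gaussV \<sigma> n) (\<lambda>z. z i ^ 1)"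
    by (rule tr1[of "\<lambda>x. x ^ 1", THEN iffD2, OF _ g1]) simp
  then show "integrable (gaussV \<sigma> n) (\<lambda>z. z i)"
    by (simp only: power_one_right)
  show "integrable (gaussV \<sigma> n) (\<lambda>z. (z i)\<^sup>2)"
    by (rule tr1[of "\<lambda>x. x\<^sup>2", THEN iffD2, OF _ g1]) simp
  have "(\<integral>z. z i ^ 1 \<partial>gaussV \<sigma> n) = (\<integral>x. normal_density 0 \<sigma> x * (x - 0) ^ (2 * 0 + 1) \<partial>lborel)"
    unfolding tr2[of "\<lambda>x. x ^ 1", OF borel_measurable_power[OF measurable_ident_sets[OF refl]]] g2
    by (simp only: mult_0_right add_0)
  also have "\<dots> = 0" by (rule integral_normal_moment_odd[OF assms(1)])
  finally show "(\<integral>z. z i \<partial>gaussV \<sigma> n) = 0" by (simp only: power_one_right)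
  have "(\<integral>z. (z i)\<^sup>2 \<partial>gaussV \<sigma> n) = (\<integral>x. normal_density 0 \<sigma> x * (x - 0) ^ (2 * 1) \<partial>lborel)"
    unfolding tr2[of "\<lambda>x. x\<^sup>2", OF borel_measurable_power[OF measurable_ident_sets[OF refl]]] g2
    by (simp only: mult_1_right)
  also have "\<dots> = \<sigma>\<^sup>2"
    by (subst integral_normal_moment_even[OF assms(1)]) (simp add: fact_numeral)
  finally show "(\<integral>z. (z i)\<^sup>2 \<partial>gaussV \<sigma> n) = \<sigma>\<^sup>2" .
qed

lemma second_moment_add:
  fixes A Z :: "'a \<Rightarrow> real"
  assumes "integrable M (\<lambda>x. (A x)\<^sup>2)" "integrable M (\<lambda>x. (Z x)\<^sup>2)"
    and "integrable M (\<lambda>x. A x * Z x)" "(\<integral>x. A x * Z x \<partial>M) = 0"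
  shows "integrable M (\<lambda>x. (A x + c * Z x)\<^sup>2)"
    and "(\<integral>x. (A x + c * Z x)\<^sup>2 \<partial>M) = (\<integral>x. (A x)\<^sup>2 \<partial>M) + c\<^sup>2 * (\<integral>x. (Z x)\<^sup>2 \<partial>M)"
proof -
  have eq: "(\<lambda>x. (A x + c * Z x)\<^sup>2) = (\<lambda>x. (A x)\<^sup>2 + (c\<^sup>2 * (Z x)\<^sup>2 + 2 * c * (A x * Z x)))"
    by (auto simp: power2_eq_square algebra_simps)
  show "integrable M (\<lambda>x. (A x + c * Z x)\<^sup>2)"
    unfolding eq using assms by auto
  show "(\<integral>x. (A x + c * Z x)\<^sup>2 \<partial>M) = (\<integral>x. (A x)\<^sup>2 \<partial>M) + c\<^sup>2 * (\<integral>x. (Z x)\<^sup>2 \<partial>M)"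
    unfolding eq using assms by simp
qed

text \<open>This is the logarithm of the N(0, \<open>\<sigma>\<close>^2) density at \<open>z\<close>
  over the N(0, \<open>\<tau>\<close>^2) density at \<open>u\<close>: \<open>z\<close> is the true
  noise sample, and \<open>u\<close> the deviation of the output from the mean that the reference
  assigns to it.\<close>

definition llr :: "real \<Rightarrow> real \<Rightarrow> real \<Rightarrow> real \<Rightarrow> real" where
  "llr \<sigma> \<tau> u z = ln (\<tau> / \<sigma>) + u\<^sup>2 / (2 * \<tau>\<^sup>2) - z\<^sup>2 / (2 * \<sigma>\<^sup>2)"

lemma exp_minus_llr:
  assumes "\<sigma> > 0" "\<tau> > 0"
  shows "exp (- llr \<sigma> \<tau> u z) = normal_density 0 \<tau> u * (1 / normal_density 0 \<sigma> z)"
proof -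
  have sq: "sqrt (2 * pi * s\<^sup>2) = sqrt (2 * pi) * s" if "s > 0" for s :: real
    using that by (simp add: real_sqrt_mult)
  have "exp (- llr \<sigma> \<tau> u z) = exp (- ln (\<tau> / \<sigma>)) * exp (- u\<^sup>2 / (2 * \<tau>\<^sup>2)) * exp (z\<^sup>2 / (2 * \<sigma>\<^sup>2))"
    by (simp add: llr_def exp_add[symmetric])
  also have "exp (- ln (\<tau> / \<sigma>)) = \<sigma> / \<tau>"
    using assms by (simp add: exp_minus)
  also have "exp (z\<^sup>2 / (2 * \<sigma>\<^sup>2)) = 1 / exp (- z\<^sup>2 / (2 * \<sigma>\<^sup>2))"
    by (simp add: exp_minus inverse_eq_divide)
  finally show ?thesis
    using assms unfolding normal_density_def sq[OF assms(1)] sq[OF assms(2)] by simp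
qed

lemma exp_minus_sum_llr:
  assumes "\<sigma> > 0" "\<tau> > 0"
  shows "exp (- (\<Sum>i<(n::nat). llr \<sigma> \<tau> (u i) (z i)))
    = (\<Prod>i<n. normal_density 0 \<tau> (u i)) * (\<Prod>i<n. 1 / normal_density 0 \<sigma> (z i))"
proof -
  have "exp (- (\<Sum>i<n. llr \<sigma> \<tau> (u i) (z i))) = (\<Prod>i<n. exp (- llr \<sigma> \<tau> (u i) (z i)))"
    by (simp add: sum_negf[symmetric] exp_sum)
  then show ?thesis
    by (simp only: exp_minus_llr[OF assms] prod.distrib)
qed

text \<open>Only second moments enter. If those of \<open>u\<close> average to
  \<open>\<tau>\<close>^2, the last two terms cancel and n ln(\<open>\<tau>\<close> /
  \<open>\<sigma>\<close>) remains, the usual Gaussian rate; this dictates the variance of each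
  reference.\<close>

lemma integral_sum_llr:
  fixes u z :: "nat \<Rightarrow> 'a \<Rightarrow> real"
  assumes "prob_space M" "\<sigma> > 0" "\<tau> > 0"
    and "\<And>i. i < n \<Longrightarrow> integrable M (\<lambda>x. (u i x)\<^sup>2)" "\<And>i. i < n \<Longrightarrow> integrable M (\<lambda>x. (z i x)\<^sup>2)"
    and "\<And>i. i < n \<Longrightarrow> (\<integral>x. (z i x)\<^sup>2 \<partial>M) = \<sigma>\<^sup>2"
  shows "integrable M (\<lambda>x. \<Sum>i<n. llr \<sigma> \<tau> (u i x) (z i x))"
    and "(\<integral>x. (\<Sum>i<n. llr \<sigma> \<tau> (u i x) (z i x)) \<partial>M)
      = real n * ln (\<tau> / \<sigma>) + (\<Sum>i<n. \<integral>x. (u i x)\<^sup>2 \<partial>M) / (2 * \<tau>\<^sup>2) - real n / 2"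
proof -
  interpret prob_space M by fact
  show "integrable M (\<lambda>x. \<Sum>i<n. llr \<sigma> \<tau> (u i x) (z i x))"
    using assms(4,5) unfolding llr_def by auto
  have "(\<integral>x. (\<Sum>i<n. llr \<sigma> \<tau> (u i x) (z i x)) \<partial>M) = (\<Sum>i<n. \<integral>x. llr \<sigma> \<tau> (u i x) (z i x) \<partial>M)"
    using assms(4,5) unfolding llr_def by (subst Bochner_Integration.integral_sum) auto
  also have "\<dots> = (\<Sum>i<n. ln (\<tau> / \<sigma>) + (\<integral>x. (u i x)\<^sup>2 \<partial>M) / (2 * \<tau>\<^sup>2) - 1 / 2)"
    using assms unfolding llr_def by (intro sum.cong refl) (simp add: prob_space)
  also have "\<dots> = real n * ln (\<tau> / \<sigma>) + (\<Sum>i<n. \<integral>x. (u i x)\<^sup>2 \<partial>M) / (2 * \<tau>\<^sup>2) - real n / 2"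
    by (simp add: sum.distrib sum_subtractf sum_divide_distrib)
  finally show "(\<integral>x. (\<Sum>i<n. llr \<sigma> \<tau> (u i x) (z i x)) \<partial>M)
      = real n * ln (\<tau> / \<sigma>) + (\<Sum>i<n. \<integral>x. (u i x)\<^sup>2 \<partial>M) / (2 * \<tau>\<^sup>2) - real n / 2" .
qed

text \<open>The Donsker--Varadhan form of Fano's inequality: \<open>exp (- L s)\<close> is the density of a
  reference measure with respect to the true one, and the reference measure gives the
  success events total mass at most \<open>card S / m\<close>.\<close>

lemma change_of_measure_fano:
  fixes L :: "'s \<Rightarrow> 'a \<Rightarrow> real"
  assumes "prob_space M" "m \<ge> 1"
    and B [measurable]: "\<And>s. s \<in> S \<Longrightarrow> B s \<in> sets M"
    and L: "\<And>s. s \<in> S \<Longrightarrow> integrable M (L s)"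
    and total: "(\<Sum>s\<in>S. \<integral>\<^sup>+x. ennreal (exp (- L s x)) \<partial>M) \<le> ennreal (card S)"
    and succ: "(\<Sum>s\<in>S. \<integral>\<^sup>+x. ennreal (exp (- L s x)) * indicator (B s) x \<partial>M) \<le> ennreal (card S / m)"
  shows "ln m * (\<Sum>s\<in>S. measure M (B s)) \<le> (\<Sum>s\<in>S. \<integral>x. L s x \<partial>M) + card S * ln 2"
proof -
  interpret prob_space M by fact
  have [measurable]: "L s \<in> borel_measurable M" if "s \<in> S" for s
    using L[OF that] by auto
  show ?thesis
  proof (cases "finite S")
    case True
    define a where "a s = (\<integral>x. exp (- L s x) \<partial>M)" for s
    define b where "b s = (\<integral>x. exp (- L s x) * indicator (B s) x \<partial>M)" for s
    have fin: "(\<integral>\<^sup>+x. ennreal (exp (- L s x)) \<partial>M) < \<infinity>" if "s \<in> S" for s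
    proof -
      have "(\<integral>\<^sup>+x. ennreal (exp (- L s x)) \<partial>M) \<le> (\<Sum>s\<in>S. \<integral>\<^sup>+x. ennreal (exp (- L s x)) \<partial>M)"
        using that True by (intro member_le_sum) auto
      also have "\<dots> < \<infinity>" using total by (rule order.strict_trans1) simp
      finally show ?thesis .
    qed
    have ia: "integrable M (\<lambda>x. exp (- L s x))" if "s \<in> S" for s
      using fin[OF that] that by (intro integrableI_nonneg) auto
    have ib: "integrable M (\<lambda>x. exp (- L s x) * indicator (B s) x)" if "s \<in> S" for s
      using integrable_mult_indicator[OF B ia, OF that that] by (simp add: mult.commute)
    have a: "(\<integral>\<^sup>+x. ennreal (exp (- L s x)) \<partial>M) = ennreal (a s)" "0 \<le> a s" if "s \<in> S" for s
      unfolding a_def using ia[OF that] by (auto intro!: nn_integral_eq_integral)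
    have b: "(\<integral>\<^sup>+x. ennreal (exp (- L s x)) * indicator (B s) x \<partial>M) = ennreal (b s)" "0 \<le> b s" if "s \<in> S" for s
      unfolding b_def using ib[OF that]
      by (auto simp: nn_integral_eq_integral[symmetric] ennreal_mult' ennreal_indicator[symmetric])
    have a_le: "(\<Sum>s\<in>S. a s) \<le> card S"
      using total a by (simp add: sum_ennreal del: ennreal_of_nat_eq_real_of_nat)
    have b_le: "(\<Sum>s\<in>S. b s) \<le> card S / m"
      using succ b assms(2) by (simp add: sum_ennreal)
    have "ln m * measure M (B s) \<le> (\<integral>x. L s x \<partial>M) + (ln 2 - 1) + (m * b s + a s) / 2"
      if s: "s \<in> S" for s
    proof -
      \<comment> \<open>This is ln y <= y - 1 at y = exp(ln m 1_B - L) / 2, together with exp(ln m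
        1_B) <= m 1_B + 1. After summation the two terms weigh at most \<open>card S\<close> each;
        halving y makes them cancel the -1 and leaves ln 2 per element of \<open>S\<close>.\<close>
      have pw: "ln m * indicator (B s) x
          \<le> L s x + (ln 2 - 1) + (m * (exp (- L s x) * indicator (B s) x) + exp (- L s x)) / 2" for x
      proof -
        let ?e = "exp (- L s x)"
        let ?I = "indicator (B s) x :: real"
        have "ln (exp (ln m * ?I - L s x) / 2) \<le> exp (ln m * ?I - L s x) / 2 - 1"
          by (intro ln_le_minus_one) auto
        then have "ln m * ?I - L s x - ln 2 \<le> exp (ln m * ?I - L s x) / 2 - 1"
          by (simp add: ln_div)
        also have "exp (ln m * ?I - L s x) = exp (ln m * ?I) * ?e"
          by (simp add: exp_diff exp_minus divide_inverse)
        also have "exp (ln m * ?I) * ?e \<le> (m * ?I + 1) * ?e"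
          using assms(2) by (intro mult_right_mono) (auto simp: indicator_def)
        finally show ?thesis by (simp add: field_simps)
      qed
      have "(\<integral>x. ln m * indicator (B s) x \<partial>M)
          \<le> (\<integral>x. L s x + (ln 2 - 1) + (m * (exp (- L s x) * indicator (B s) x) + exp (- L s x)) / 2 \<partial>M)"
        using L[OF s] ia[OF s] ib[OF s] B[OF s] by (intro integral_mono pw) (auto simp: emeasure_eq_measure)
      then show ?thesis
        using L[OF s] ia[OF s] ib[OF s] B[OF s]
        by (simp add: a_def b_def prob_space)
    qed
    then have "(\<Sum>s\<in>S. ln m * measure M (B s)) \<le> (\<Sum>s\<in>S. (\<integral>x. L s x \<partial>M) + (ln 2 - 1) + (m * b s + a s) / 2)"
      by (intro sum_mono) auto
    then have "ln m * (\<Sum>s\<in>S. measure M (B s)) \<le>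
        (\<Sum>s\<in>S. \<integral>x. L s x \<partial>M) + card S * (ln 2 - 1) + (m * (\<Sum>s\<in>S. b s) + (\<Sum>s\<in>S. a s)) / 2"
      by (simp add: sum.distrib sum_distrib_left sum_divide_distrib[symmetric])
    also have "m * (\<Sum>s\<in>S. b s) \<le> card S"
      using b_le assms(2) by (simp add: field_simps)
    also note a_le
    finally show ?thesis
      by (simp add: algebra_simps)
  qed simp
qed

section \<open>Integrals over the noise space\<close>

lemma noiseM_integral_1:
  fixes f :: "_ \<Rightarrow> real"
  assumes "\<sigma> > 0" "integrable (gaussV \<sigma> n) f"
  shows "integrable (noiseM \<sigma> n k) (\<lambda>z. f (fst z))"
    and "(\<integral>z. f (fst z) \<partial>noiseM \<sigma> n k) = (\<integral>z. f z \<partial>gaussV \<sigma> n)"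
  unfolding noiseM_def
  by (intro pair_prob_integral_fst prob_space_pair prob_space_gaussV assms)+

lemma noiseM_integral_2:
  fixes f :: "_ \<Rightarrow> real"
  assumes "\<sigma> > 0" "integrable (gaussV \<sigma> n) f"
  shows "integrable (noiseM \<sigma> n k) (\<lambda>z. f (fst (snd z)))"
    and "(\<integral>z. f (fst (snd z)) \<partial>noiseM \<sigma> n k) = (\<integral>z. f z \<partial>gaussV \<sigma> n)"
  unfolding noiseM_def
  using pair_prob_integral_fst[OF prob_space_gaussV[OF assms(1)] prob_space_gaussV[OF assms(1)] assms(2), of k]
  by (simp_all add: pair_prob_integral_snd[where g="\<lambda>x. f (fst x)"] prob_space_pair prob_space_gaussV assms(1))

lemma noiseM_integral_3:
  fixes f :: "_ \<Rightarrow> real"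
  assumes "\<sigma> > 0" "integrable (gaussV \<sigma> k) f"
  shows "integrable (noiseM \<sigma> n k) (\<lambda>z. f (snd (snd z)))"
    and "(\<integral>z. f (snd (snd z)) \<partial>noiseM \<sigma> n k) = (\<integral>z. f z \<partial>gaussV \<sigma> k)"
  unfolding noiseM_def
  using pair_prob_integral_snd[OF prob_space_gaussV[OF assms(1)] prob_space_gaussV[OF assms(1)] assms(2), of n]
  by (simp_all add: pair_prob_integral_snd[where g="\<lambda>x. f (snd x)"] prob_space_pair prob_space_gaussV assms(1))

lemma gaussV_shifted_second_moment:
  assumes "\<sigma> > 0" "i < n"
  shows "integrable (gaussV \<sigma> n) (\<lambda>z. (b + z i)\<^sup>2)"
    and "(\<integral>z. (b + z i)\<^sup>2 \<partial>gaussV \<sigma> n) = b\<^sup>2 + \<sigma>\<^sup>2"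
proof -
  interpret prob_space "gaussV \<sigma> n" by (rule prob_space_gaussV) fact
  note m = gaussV_component_moments[OF assms]
  show "integrable (gaussV \<sigma> n) (\<lambda>z. (b + z i)\<^sup>2)"
    using second_moment_add(1)[of "gaussV \<sigma> n" "\<lambda>_. b" "\<lambda>z. z i" 1] m by simp
  show "(\<integral>z. (b + z i)\<^sup>2 \<partial>gaussV \<sigma> n) = b\<^sup>2 + \<sigma>\<^sup>2"
    using second_moment_add(2)[of "gaussV \<sigma> n" "\<lambda>_. b" "\<lambda>z. z i" 1] m prob_space by simp
qed

text \<open>The cross term vanishes because \<open>A\<close> sees only the second noise vector,
  which is independent of the first and the first is centred. The BS symbol has this form, since
  feedback reaches it only through Y2; \<open>c\<close> is 1 for Y1 and minus the estimator
  coefficient for the residual of Y2.\<close>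

lemma noiseM_second_moment_add:
  assumes "\<sigma> > 0" "i < n" "integrable (gaussV \<sigma> n) (\<lambda>z. (A z)\<^sup>2)" "A \<in> borel_measurable (gaussV \<sigma> n)"
  shows "integrable (noiseM \<sigma> n k) (\<lambda>z. (A (fst (snd z)) + c * fst z i)\<^sup>2)"
    and "(\<integral>z. (A (fst (snd z)) + c * fst z i)\<^sup>2 \<partial>noiseM \<sigma> n k)
      = (\<integral>z. (A z)\<^sup>2 \<partial>gaussV \<sigma> n) + c\<^sup>2 * \<sigma>\<^sup>2"
proof -
  interpret prob_space "gaussV \<sigma> n" by (rule prob_space_gaussV) fact
  note m = gaussV_component_moments[OF assms(1,2)]
  have A: "integrable (gaussV \<sigma> n) A"
    by (rule square_integrable_imp_integrable[OF assms(4,3)])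
  have Q: "prob_space (gaussV \<sigma> n \<Otimes>\<^sub>M gaussV \<sigma> k)"
    by (intro prob_space_pair prob_space_gaussV assms)
  have "integrable (gaussV \<sigma> n \<Otimes>\<^sub>M gaussV \<sigma> k) (\<lambda>z. A (fst z))"
    by (intro pair_prob_integral_fst prob_space_gaussV assms A)
  from pair_prob_integral_mult[OF prob_space_gaussV[OF assms(1)] Q m(1) this]
  have AZ: "integrable (noiseM \<sigma> n k) (\<lambda>z. A (fst (snd z)) * fst z i)"
    "(\<integral>z. A (fst (snd z)) * fst z i \<partial>noiseM \<sigma> n k) = 0"
    unfolding noiseM_def by (simp_all add: m(2) mult.commute)
  note * = noiseM_integral_2[OF assms(1,3), of k] noiseM_integral_1[OF assms(1) m(3), of k]
  show "integrable (noiseM \<sigma> n k) (\<lambda>z. (A (fst (snd z)) + c * fst z i)\<^sup>2)"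
    by (rule second_moment_add(1)) (fact * AZ)+
  show "(\<integral>z. (A (fst (snd z)) + c * fst z i)\<^sup>2 \<partial>noiseM \<sigma> n k)
      = (\<integral>z. (A z)\<^sup>2 \<partial>gaussV \<sigma> n) + c\<^sup>2 * \<sigma>\<^sup>2"
    by (subst second_moment_add(2)) (fact * AZ | simp add: * m)+
qed

text \<open>The shift may depend on the remaining noise \<open>b\<close>: for each fixed
  \<open>b\<close> it is an ordinary translation. This accommodates X1, which is a function of the
  noise in Y2.\<close>

lemma nn_integral_pair_unnormalize:
  fixes t :: "'b \<Rightarrow> nat \<Rightarrow> real"
  assumes "\<sigma> > 0" "prob_space Q"
    and [measurable]: "H \<in> borel_measurable (lebV n \<Otimes>\<^sub>M Q)"
    and [measurable]: "\<And>i. i \<in> {..<n} \<Longrightarrow> (\<lambda>b. t b i) \<in> borel_measurable Q"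
  shows "(\<integral>\<^sup>+z. H (\<lambda>i\<in>{..<n}. t (snd z) i + fst z i, snd z) * ennreal (\<Prod>i<n. 1 / normal_density 0 \<sigma> (fst z i))
        \<partial>(gaussV \<sigma> n \<Otimes>\<^sub>M Q)) = (\<integral>\<^sup>+b. \<integral>\<^sup>+y. H (y, b) \<partial>lebV n \<partial>Q)"
proof -
  interpret G: prob_space "gaussV \<sigma> n" by (rule prob_space_gaussV) fact
  interpret Q: prob_space Q by fact
  interpret pair_sigma_finite "gaussV \<sigma> n" Q ..
  have sh: "(\<lambda>z. (\<lambda>i\<in>{..<n}. t (snd z) i + fst z i, snd z)) \<in> gaussV \<sigma> n \<Otimes>\<^sub>M Q \<rightarrow>\<^sub>M lebV n \<Otimes>\<^sub>M Q"
    by measurable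
  have dens: "(\<lambda>z. ennreal (\<Prod>i<n. 1 / normal_density 0 \<sigma> (fst z i))) \<in> borel_measurable (gaussV \<sigma> n \<Otimes>\<^sub>M Q)"
    by measurable
  have "(\<integral>\<^sup>+z. H (\<lambda>i\<in>{..<n}. t (snd z) i + fst z i, snd z) * ennreal (\<Prod>i<n. 1 / normal_density 0 \<sigma> (fst z i))
        \<partial>(gaussV \<sigma> n \<Otimes>\<^sub>M Q))
     = (\<integral>\<^sup>+b. \<integral>\<^sup>+z. H (\<lambda>i\<in>{..<n}. t b i + z i, b) * ennreal (\<Prod>i<n. 1 / normal_density 0 \<sigma> (z i))
        \<partial>gaussV \<sigma> n \<partial>Q)"
    by (subst nn_integral_snd[symmetric])
       (auto intro!: borel_measurable_times_ennreal dens measurable_compose[OF sh])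
  also have "\<dots> = (\<integral>\<^sup>+b. \<integral>\<^sup>+y. H (y, b) \<partial>lebV n \<partial>Q)"
    by (intro nn_integral_cong nn_integral_gaussV_unnormalize[OF assms(1), where H="\<lambda>y. H (y, _)"]) measurable
  finally show ?thesis .
qed

text \<open>Measurability of a partial integral is available for integration over the second factor
  of a pair, so the first coordinate has to be moved to the end.\<close>

lemma borel_measurable_rotate:
  assumes "F \<in> borel_measurable (A \<Otimes>\<^sub>M B \<Otimes>\<^sub>M C)"
  shows "(\<lambda>w. F (snd w, fst (fst w), snd (fst w))) \<in> borel_measurable ((B \<Otimes>\<^sub>M C) \<Otimes>\<^sub>M A)"
proof -
  have "(\<lambda>w. (snd w, fst (fst w), snd (fst w))) \<in> (B \<Otimes>\<^sub>M C) \<Otimes>\<^sub>M A \<rightarrow>\<^sub>M A \<Otimes>\<^sub>M B \<Otimes>\<^sub>M C"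
    by (intro measurable_Pair measurable_snd measurable_compose[OF measurable_fst measurable_fst]
        measurable_compose[OF measurable_fst measurable_snd])
  then show ?thesis
    by (rule measurable_compose) (rule assms)
qed

text \<open>The order matters: the mean \<open>t1\<close> of Y1 depends on the second noise, so the
  first noise is removed while the second is still fixed. After that nothing refers to
  \<open>t1\<close>, and the other two shifts are constants.\<close>

lemma nn_integral_noiseM_unnormalize:
  fixes t1 :: "(nat \<Rightarrow> real) \<Rightarrow> nat \<Rightarrow> real"
  assumes "\<sigma> > 0"
    and F: "F \<in> borel_measurable (lebV n \<Otimes>\<^sub>M lebV n \<Otimes>\<^sub>M lebV k)"
    and [measurable]: "\<And>i. i \<in> {..<n} \<Longrightarrow> (\<lambda>b. t1 b i) \<in> borel_measurable (lebV n)"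
  shows "(\<integral>\<^sup>+z. F (\<lambda>i\<in>{..<n}. t1 (fst (snd z)) i + fst z i, \<lambda>i\<in>{..<n}. t2 i + fst (snd z) i,
        \<lambda>j\<in>{..<k}. t3 j + snd (snd z) j)
      * (ennreal (\<Prod>i<n. 1 / normal_density 0 \<sigma> (fst z i))
        * ennreal (\<Prod>i<n. 1 / normal_density 0 \<sigma> (fst (snd z) i))
        * ennreal (\<Prod>j<k. 1 / normal_density 0 \<sigma> (snd (snd z) j))) \<partial>noiseM \<sigma> n k)
    = (\<integral>\<^sup>+y3. \<integral>\<^sup>+y2. \<integral>\<^sup>+y1. F (y1, y2, y3) \<partial>lebV n \<partial>lebV n \<partial>lebV k)" (is "?lhs = _")
proof -
  note [measurable] = F
  let ?d = "\<lambda>m z. ennreal (\<Prod>i<m. 1 / normal_density 0 \<sigma> (z i))"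
  interpret L: sigma_finite_measure "lebV n" by (rule sigma_finite_lebV)
  define F' where "F' = (\<lambda>(y2, y3). \<integral>\<^sup>+y1. F (y1, y2, y3) \<partial>lebV n)"
  have F' [measurable]: "F' \<in> borel_measurable (lebV n \<Otimes>\<^sub>M lebV k)"
  proof -
    have "(\<lambda>w. F (snd w, fst (fst w), snd (fst w))) \<in> borel_measurable ((lebV n \<Otimes>\<^sub>M lebV k) \<Otimes>\<^sub>M lebV n)"
      by (rule borel_measurable_rotate[OF F])
    from L.borel_measurable_nn_integral_fst[OF this] show ?thesis
      unfolding F'_def by (simp add: case_prod_beta)
  qed
  have Fsec: "(\<lambda>y. F (y, restrict a {..<n}, restrict b {..<k})) \<in> borel_measurable (lebV n)" for a b
  proof (rule measurable_compose[OF _ F])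
    have "(restrict a {..<n}, restrict b {..<k}) \<in> space (lebV n \<Otimes>\<^sub>M lebV k)"
      by (simp add: space_pair_measure space_PiM)
    then show "(\<lambda>y. (y, restrict a {..<n}, restrict b {..<k})) \<in> lebV n \<rightarrow>\<^sub>M lebV n \<Otimes>\<^sub>M lebV n \<Otimes>\<^sub>M lebV k"
      by (intro measurable_Pair2')
  qed
  have "?lhs = (\<integral>\<^sup>+z. (F (\<lambda>i\<in>{..<n}. t1 (fst (snd z)) i + fst z i, \<lambda>i\<in>{..<n}. t2 i + fst (snd z) i,
        \<lambda>j\<in>{..<k}. t3 j + snd (snd z) j) * (?d n (fst (snd z)) * ?d k (snd (snd z)))) * ?d n (fst z)
        \<partial>(gaussV \<sigma> n \<Otimes>\<^sub>M (gaussV \<sigma> n \<Otimes>\<^sub>M gaussV \<sigma> k)))"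
    unfolding noiseM_def by (simp add: mult_ac)
  also have "\<dots> = (\<integral>\<^sup>+b. \<integral>\<^sup>+y. F (y, \<lambda>i\<in>{..<n}. t2 i + fst b i, \<lambda>j\<in>{..<k}. t3 j + snd b j)
        * (?d n (fst b) * ?d k (snd b)) \<partial>lebV n \<partial>(gaussV \<sigma> n \<Otimes>\<^sub>M gaussV \<sigma> k))"
    using nn_integral_pair_unnormalize[of \<sigma> "gaussV \<sigma> n \<Otimes>\<^sub>M gaussV \<sigma> k"
       "\<lambda>(y, b). F (y, \<lambda>i\<in>{..<n}. t2 i + fst b i, \<lambda>j\<in>{..<k}. t3 j + snd b j) * (?d n (fst b) * ?d k (snd b))"
       n "\<lambda>b. t1 (fst b)"] assms(1)
    by (simp add: prob_space_pair prob_space_gaussV)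
  also have "\<dots> = (\<integral>\<^sup>+b. (F' (\<lambda>i\<in>{..<n}. t2 i + fst b i, \<lambda>j\<in>{..<k}. t3 j + snd b j) * ?d k (snd b)) * ?d n (fst b)
       \<partial>(gaussV \<sigma> n \<Otimes>\<^sub>M gaussV \<sigma> k))"
    unfolding F'_def
    by (intro nn_integral_cong, subst nn_integral_multc[OF Fsec]) (simp add: mult_ac)
  also have "\<dots> = (\<integral>\<^sup>+b. \<integral>\<^sup>+y. F' (y, \<lambda>j\<in>{..<k}. t3 j + b j) * ?d k b \<partial>lebV n \<partial>gaussV \<sigma> k)"
    using nn_integral_pair_unnormalize[of \<sigma> "gaussV \<sigma> k"
       "\<lambda>(y, b). F' (y, \<lambda>j\<in>{..<k}. t3 j + b j) * ?d k b" n "\<lambda>_. t2"] assms(1)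
    by (simp add: prob_space_gaussV)
  also have "\<dots> = (\<integral>\<^sup>+b. (\<integral>\<^sup>+y. F' (y, \<lambda>j\<in>{..<k}. t3 j + b j) \<partial>lebV n) * ?d k b \<partial>gaussV \<sigma> k)"
    by (intro nn_integral_cong) (simp add: nn_integral_multc)
  also have "\<dots> = (\<integral>\<^sup>+b. \<integral>\<^sup>+y. F' (y, b) \<partial>lebV n \<partial>lebV k)"
    by (rule nn_integral_gaussV_unnormalize[OF assms(1)]) measurable
  finally show ?thesis
    by (simp add: F'_def)
qed

section \<open>Rate bounds for a single code\<close>

lemma nn_integral_noiseM_2:
  assumes "\<sigma> > 0" and [measurable]: "h \<in> borel_measurable (gaussV \<sigma> n)"
  shows "(\<integral>\<^sup>+z. h (fst (snd z)) \<partial>noiseM \<sigma> n k) = (\<integral>\<^sup>+z. h z \<partial>gaussV \<sigma> n)"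
proof -
  interpret P: prob_space "gaussV \<sigma> n" by (rule prob_space_gaussV) fact
  interpret K: prob_space "gaussV \<sigma> k" by (rule prob_space_gaussV) fact
  interpret Q: prob_space "gaussV \<sigma> n \<Otimes>\<^sub>M gaussV \<sigma> k"
    by (intro prob_space_pair prob_space_gaussV assms)
  show ?thesis
    unfolding noiseM_def
    by (simp add: Q.nn_integral_fst[symmetric] K.nn_integral_fst[symmetric] P.emeasure_space_1 K.emeasure_space_1)
qed

text \<open>A decoder outputs one message, so its decision regions are disjoint. This is the source
  of the success probability 1 / m under a reference law that ignores the message.\<close>

lemma sum_indicator_singleton_le:
  "(\<Sum>s<m. indicator {s} (x :: nat) :: ennreal) \<le> 1"
proof -
  have "(\<Sum>s<m. indicator {s} x :: ennreal) = (\<Sum>s<m. if s = x then 1 else 0)"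
    by (intro sum.cong) (auto simp: indicator_def)
  then show ?thesis by simp
qed

lemma sum_mult_indicator_singleton_le:
  "(\<Sum>s<m. c * indicator {s} (x :: nat) :: ennreal) \<le> c"
  unfolding sum_distrib_left[symmetric]
  using mult_left_mono[OF sum_indicator_singleton_le, of c x m] by simp

lemma nn_integral_shifted_density:
  assumes "\<tau> > 0"
  shows "(\<integral>\<^sup>+y. (\<Prod>i<n. ennreal (normal_density (c i) \<tau> (y i))) \<partial>lebV n) = 1"
  using nn_integral_causal_density[OF assms, of "\<lambda>i _. c i" n] by simp

text \<open>The expected log likelihood ratio is affine in the second moment, so a power bound that
  holds only on average over the messages is enough.\<close>

lemma average_llr_le:
  fixes V :: "'s \<Rightarrow> real"
  assumes "\<tau> > 0" "(\<Sum>s\<in>S. V s) \<le> card S * (real n * \<tau>\<^sup>2)"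
  shows "(\<Sum>s\<in>S. real n * ln (\<tau> / \<sigma>) + V s / (2 * \<tau>\<^sup>2) - real n / 2) \<le> card S * (real n * ln (\<tau> / \<sigma>))"
proof -
  have "(\<Sum>s\<in>S. V s) / (2 * \<tau>\<^sup>2) \<le> card S * (real n * \<tau>\<^sup>2) / (2 * \<tau>\<^sup>2)"
    using assms by (intro divide_right_mono) auto
  also have "\<dots> = card S * (real n / 2)"
    using assms(1) by simp
  finally show ?thesis
    by (simp add: sum.distrib sum_subtractf sum_divide_distrib)
qed

section \<open>A fixed code: success events, powers, Fano bound\<close>

locale full_duplex_code =
  fixes \<gamma>1 \<gamma>m \<gamma>s \<gamma>2 \<sigma> P1 P2 :: real and n k M1 M2 :: nat
    and f1 :: "nat \<Rightarrow> nat \<Rightarrow> (nat \<Rightarrow> real) \<Rightarrow> real" and g2 g3 :: "nat \<Rightarrow> nat \<Rightarrow> real"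
    and d2 :: "(nat \<Rightarrow> real) \<Rightarrow> (nat \<Rightarrow> real) \<Rightarrow> nat" and d1 :: "nat \<Rightarrow> (nat \<Rightarrow> real) \<Rightarrow> nat"
    and \<epsilon> :: real
  assumes sigma_pos: "\<sigma> > 0" and n_pos: "n > 0" and P1_nonneg: "P1 \<ge> 0"
    and code: "code_ok \<gamma>1 \<gamma>m \<gamma>s \<gamma>2 \<sigma> P1 P2 n k M1 M2 f1 g2 g3 d2 d1 \<epsilon>"
begin

abbreviation "N \<equiv> noiseM \<sigma> n k"
abbreviation "S \<equiv> {..<M1} \<times> {..<M2}"
abbreviation "Y2 s2 z \<equiv> sigY2 \<gamma>2 n (g2 s2) (fst (snd z))"
abbreviation "Y1 s1 s2 z \<equiv> sigY1 \<gamma>1 \<gamma>m \<gamma>2 f1 s1 n (g2 s2) (fst z) (fst (snd z))"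
abbreviation "Y3 s2 z \<equiv> sigY3 \<gamma>s k (g3 s2) (snd (snd z))"
abbreviation "X s1 s2 i z2 \<equiv> f1 s1 i (sigY2 \<gamma>2 n (g2 s2) z2)"

definition good :: "nat \<Rightarrow> nat \<Rightarrow> ((nat \<Rightarrow> real) \<times> (nat \<Rightarrow> real) \<times> (nat \<Rightarrow> real)) set" where
  "good s1 s2 = {z \<in> space N. d2 (Y1 s1 s2 z) (Y3 s2 z) = s1 \<and> d1 s1 (Y2 s2 z) = s2}"

definition p2 :: real where
  "p2 = (\<Sum>s2<M2. \<Sum>i<n. (g2 s2 i)\<^sup>2) / (real M2 * real n)"

text \<open>The normalisation is by the main-channel length \<open>n\<close>, not by
  \<open>k\<close>, so that \<open>p2\<close> and \<open>p3\<close> share the budget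
  \<open>P2\<close> and match the definition of the side-channel SNR.\<close>

definition p3 :: real where
  "p3 = (\<Sum>s2<M2. \<Sum>j<k. (g3 s2 j)\<^sup>2) / (real M2 * real n)"

lemma M1_pos: "M1 \<ge> 1" and M2_pos: "M2 \<ge> 1"
  using code by (auto simp: code_ok_def)

lemma causal: "(\<And>j. j < i \<Longrightarrow> y j = y' j) \<Longrightarrow> f1 s i y = f1 s i y'"
  using code unfolding code_ok_def by blast

lemma f1_measurable [measurable]: "f1 s i \<in> borel_measurable (PiM {..<n} (\<lambda>_. borel))"
  using code unfolding code_ok_def by blast

lemma d1_measurable [measurable]: "d1 s \<in> PiM {..<n} (\<lambda>_. borel) \<rightarrow>\<^sub>M count_space UNIV"
  using code unfolding code_ok_def by blast

lemma d2_measurable: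
  "(\<lambda>p. d2 (fst p) (snd p)) \<in> PiM {..<n} (\<lambda>_. borel) \<Otimes>\<^sub>M PiM {..<k} (\<lambda>_. borel) \<rightarrow>\<^sub>M count_space UNIV"
  using code unfolding code_ok_def case_prod_beta by blast

lemma d2_compose_measurable [measurable (raw)]:
  assumes "a \<in> Q \<rightarrow>\<^sub>M PiM {..<n} (\<lambda>_. borel)" "b \<in> Q \<rightarrow>\<^sub>M PiM {..<k} (\<lambda>_. borel)"
  shows "(\<lambda>x. d2 (a x) (b x)) \<in> Q \<rightarrow>\<^sub>M count_space UNIV"
  using measurable_compose[OF measurable_Pair[OF assms] d2_measurable] by simp

lemma sigY2_measurable [measurable]:
  "sigY2 \<gamma>2 n x \<in> gaussV \<sigma> n \<rightarrow>\<^sub>M PiM {..<n} (\<lambda>_. borel)"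
  unfolding sigY2_def[abs_def] by measurable

lemma sigY3_measurable [measurable]:
  "sigY3 \<gamma>s k x \<in> gaussV \<sigma> k \<rightarrow>\<^sub>M PiM {..<k} (\<lambda>_. borel)"
  unfolding sigY3_def[abs_def] by measurable

lemma X_measurable [measurable]: "X s1 s2 i \<in> borel_measurable (gaussV \<sigma> n)"
  by measurable

lemma sigY1_eq: "sigY1 \<gamma>1 \<gamma>m \<gamma>2 f1 s1 n (g2 s2) z1 z2
    = (\<lambda>i\<in>{..<n}. (\<gamma>1 * X s1 s2 i z2 + \<gamma>m * g2 s2 i) + z1 i)"
  by (auto simp: sigY1_def sigX1_def fun_eq_iff restrict_def)

lemma Y1_measurable [measurable]: "Y1 s1 s2 \<in> N \<rightarrow>\<^sub>M PiM {..<n} (\<lambda>_. borel)"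
  unfolding sigY1_eq noiseM_def by measurable

lemma Y2_measurable [measurable]: "Y2 s2 \<in> N \<rightarrow>\<^sub>M PiM {..<n} (\<lambda>_. borel)"
  unfolding noiseM_def by measurable

lemma Y3_measurable [measurable]: "Y3 s2 \<in> N \<rightarrow>\<^sub>M PiM {..<k} (\<lambda>_. borel)"
  unfolding noiseM_def by measurable

lemma good_sets [measurable]: "good s1 s2 \<in> sets N"
  unfolding good_def by measurable

lemma prob_space_N: "prob_space N"
  unfolding noiseM_def by (intro prob_space_pair prob_space_gaussV sigma_pos)

lemma success_probability:
  "(1 - \<epsilon>) * (real M1 * real M2) \<le> (\<Sum>s\<in>S. measure N (good (fst s) (snd s)))"
proof -
  interpret prob_space N by (rule prob_space_N)
  have "(\<Sum>s1<M1. \<Sum>s2<M2. measure N (space N - good s1 s2)) \<le> \<epsilon> * real M1 * real M2"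
  proof -
    have "space N - good s1 s2 = {(z1, z2, z3) \<in> space N.
           d2 (sigY1 \<gamma>1 \<gamma>m \<gamma>2 f1 s1 n (g2 s2) z1 z2) (sigY3 \<gamma>s k (g3 s2) z3) \<noteq> s1 \<or>
           d1 s1 (sigY2 \<gamma>2 n (g2 s2) z2) \<noteq> s2}" for s1 s2
      by (auto simp: good_def)
    then show ?thesis using code by (simp add: code_ok_def)
  qed
  then show ?thesis
    by (simp add: prob_compl sum.cartesian_product' sum_subtractf algebra_simps)
qed

text \<open>Change of measure over all message pairs, divided by their number. Here \<open>m\<close>
  is the number of values to be guessed: \<open>M1\<close>, \<open>M2\<close>, or their product for
  the sum rate; \<open>b\<close> bounds the average expected log likelihood ratio.\<close>

lemma fano:
  assumes m: "m \<ge> 1" and L: "\<And>s1 s2. s1 < M1 \<Longrightarrow> s2 < M2 \<Longrightarrow> integrable N (L s1 s2)"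
    and total: "\<And>s1 s2. s1 < M1 \<Longrightarrow> s2 < M2 \<Longrightarrow> (\<integral>\<^sup>+z. ennreal (exp (- L s1 s2 z)) \<partial>N) = 1"
    and succ: "(\<Sum>s1<M1. \<Sum>s2<M2. \<integral>\<^sup>+z. ennreal (exp (- L s1 s2 z)) * indicator (good s1 s2) z \<partial>N)
      \<le> ennreal (real M1 * real M2 / m)"
    and bound: "(\<Sum>s1<M1. \<Sum>s2<M2. \<integral>z. L s1 s2 z \<partial>N) \<le> real M1 * real M2 * b"
  shows "(1 - \<epsilon>) * ln m \<le> b + ln 2"
proof -
  have "ln m * (\<Sum>s\<in>S. measure N (good (fst s) (snd s)))
      \<le> (\<Sum>s\<in>S. \<integral>z. L (fst s) (snd s) z \<partial>N) + card S * ln 2"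
  proof (rule change_of_measure_fano[OF prob_space_N m])
    show "(\<Sum>s\<in>S. \<integral>\<^sup>+z. ennreal (exp (- L (fst s) (snd s) z)) \<partial>N) \<le> ennreal (card S)"
      by (subst sum.cong[OF refl, of _ _ "\<lambda>_. 1"])
         (auto simp: total ennreal_of_nat_eq_real_of_nat ennreal_mult)
    show "(\<Sum>s\<in>S. \<integral>\<^sup>+z. ennreal (exp (- L (fst s) (snd s) z)) * indicator (good (fst s) (snd s)) z \<partial>N)
        \<le> ennreal (card S / m)"
      using succ by (simp add: sum.cartesian_product')
  qed (use L in auto)
  moreover have "ln m * ((1 - \<epsilon>) * (real M1 * real M2)) \<le> ln m * (\<Sum>s\<in>S. measure N (good (fst s) (snd s)))"
    using m by (intro mult_left_mono success_probability) auto
  moreover have "(\<Sum>s\<in>S. \<integral>z. L (fst s) (snd s) z \<partial>N) \<le> real M1 * real M2 * b"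
    using bound by (simp add: sum.cartesian_product')
  ultimately have "(real M1 * real M2) * ((1 - \<epsilon>) * ln m) \<le> (real M1 * real M2) * (b + ln 2)"
    by (simp add: algebra_simps)
  then show ?thesis
    using M1_pos M2_pos by (simp add: mult_le_cancel_left)
qed

text \<open>The code constrains a sum of extended nonnegative integrals. Each single term is at most
  the finite total, which yields integrability first and only then the same bound for real
  integrals.\<close>

lemma X_power:
  shows "\<And>s1 s2 i. s1 < M1 \<Longrightarrow> s2 < M2 \<Longrightarrow> i < n \<Longrightarrow> integrable (gaussV \<sigma> n) (\<lambda>z. (X s1 s2 i z)\<^sup>2)"
    and "(\<Sum>s1<M1. \<Sum>s2<M2. \<Sum>i<n. \<integral>z. (X s1 s2 i z)\<^sup>2 \<partial>gaussV \<sigma> n) \<le> real M1 * real M2 * real n * P1"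
proof -
  let ?a = "\<lambda>s1 s2 i. \<integral>\<^sup>+z. ennreal ((X s1 s2 i z)\<^sup>2) \<partial>gaussV \<sigma> n"
  have "(\<integral>\<^sup>+(z1, z2, z3). ennreal (\<Sum>i<n. (sigX1 f1 s1 \<gamma>2 n (g2 s2) z2 i)\<^sup>2) \<partial>N) = (\<Sum>i<n. ?a s1 s2 i)"
    for s1 s2
  proof -
    have "(\<integral>\<^sup>+(z1, z2, z3). ennreal (\<Sum>i<n. (sigX1 f1 s1 \<gamma>2 n (g2 s2) z2 i)\<^sup>2) \<partial>N)
      = (\<integral>\<^sup>+z. (\<Sum>i<n. ennreal ((X s1 s2 i (fst (snd z)))\<^sup>2)) \<partial>N)"
      by (intro nn_integral_cong) (auto simp: sigX1_def split: prod.splits intro!: sum.cong)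
    also have "\<dots> = (\<integral>\<^sup>+z. (\<Sum>i<n. ennreal ((X s1 s2 i z)\<^sup>2)) \<partial>gaussV \<sigma> n)"
      by (rule nn_integral_noiseM_2[OF sigma_pos]) measurable
    also have "\<dots> = (\<Sum>i<n. ?a s1 s2 i)"
      by (rule nn_integral_sum) measurable
    finally show ?thesis .
  qed
  then have tot: "(\<Sum>s1<M1. \<Sum>s2<M2. \<Sum>i<n. ?a s1 s2 i) \<le> ennreal (real M1 * real M2 * real n * P1)"
    using code by (simp add: code_ok_def)
  have fin: "?a s1 s2 i < \<infinity>" if "s1 < M1" "s2 < M2" "i < n" for s1 s2 i
  proof -
    have "?a s1 s2 i \<le> (\<Sum>i<n. ?a s1 s2 i)"
      using that by (intro member_le_sum) auto
    also have "\<dots> \<le> (\<Sum>s2<M2. \<Sum>i<n. ?a s1 s2 i)"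
      using that by (intro member_le_sum[where f="\<lambda>s2. \<Sum>i<n. ?a s1 s2 i"]) auto
    also have "\<dots> \<le> (\<Sum>s1<M1. \<Sum>s2<M2. \<Sum>i<n. ?a s1 s2 i)"
      using that by (intro member_le_sum[where f="\<lambda>s1. \<Sum>s2<M2. \<Sum>i<n. ?a s1 s2 i"]) auto
    also have "\<dots> < \<infinity>"
      using tot by (rule order.strict_trans1) simp
    finally show ?thesis .
  qed
  show int: "integrable (gaussV \<sigma> n) (\<lambda>z. (X s1 s2 i z)\<^sup>2)" if "s1 < M1" "s2 < M2" "i < n" for s1 s2 i
    using fin[OF that] by (intro integrableI_nonneg) auto
  have "?a s1 s2 i = ennreal (\<integral>z. (X s1 s2 i z)\<^sup>2 \<partial>gaussV \<sigma> n)" if "s1 < M1" "s2 < M2" "i < n" for s1 s2 i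
    using int[OF that] by (intro nn_integral_eq_integral) auto
  then have "(\<Sum>s1<M1. \<Sum>s2<M2. \<Sum>i<n. ?a s1 s2 i)
      = ennreal (\<Sum>s1<M1. \<Sum>s2<M2. \<Sum>i<n. \<integral>z. (X s1 s2 i z)\<^sup>2 \<partial>gaussV \<sigma> n)"
    by (simp add: sum_ennreal sum_nonneg)
  with tot show "(\<Sum>s1<M1. \<Sum>s2<M2. \<Sum>i<n. \<integral>z. (X s1 s2 i z)\<^sup>2 \<partial>gaussV \<sigma> n) \<le> real M1 * real M2 * real n * P1"
    using P1_nonneg by (simp add: ennreal_le_iff)
qed

lemma p2_nonneg: "p2 \<ge> 0" and p3_nonneg: "p3 \<ge> 0"
  by (auto simp: p2_def p3_def intro!: divide_nonneg_nonneg sum_nonneg)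

lemma sum_g2: "(\<Sum>s2<M2. \<Sum>i<n. (g2 s2 i)\<^sup>2) = real M2 * real n * p2"
  and sum_g3: "(\<Sum>s2<M2. \<Sum>j<k. (g3 s2 j)\<^sup>2) = real M2 * real n * p3"
  using M2_pos n_pos by (simp_all add: p2_def p3_def)

lemma power_split: "p2 + p3 \<le> P2"
proof -
  have "real M2 * real n * (p2 + p3) \<le> real M2 * real n * P2"
    using code by (simp add: code_ok_def sum.distrib sum_g2 sum_g3 distrib_left)
  then show ?thesis
    using M2_pos n_pos by (simp add: mult_le_cancel_left)
qed

end

lemma measurable_indicator_singleton [measurable (raw)]:
  assumes "f \<in> Q \<rightarrow>\<^sub>M count_space UNIV"
  shows "(\<lambda>x. indicator {a} (f x) :: ennreal) \<in> borel_measurable Q"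
  by (rule measurable_compose[OF assms]) simp

section \<open>The two individual rates\<close>

context full_duplex_code
begin

text \<open>Y2 contains no BS signal, so the reference is white noise whose variance is the average
  received power. \<open>S1\<close> is a mere parameter of the decoder \<open>d1\<close>.\<close>

lemma rate2_bound:
  "(1 - \<epsilon>) * ln M2 \<le> real n / 2 * ln ((\<sigma>\<^sup>2 + \<gamma>2\<^sup>2 * p2) / \<sigma>\<^sup>2) + ln 2"
proof -
  define \<tau> where "\<tau> = sqrt (\<sigma>\<^sup>2 + \<gamma>2\<^sup>2 * p2)"
  have vpos: "\<sigma>\<^sup>2 + \<gamma>2\<^sup>2 * p2 > 0"
    using sigma_pos p2_nonneg by (intro add_pos_nonneg) auto
  then have tau_pos: "\<tau> > 0" and tau2: "\<tau>\<^sup>2 = \<sigma>\<^sup>2 + \<gamma>2\<^sup>2 * p2"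
    by (auto simp: \<tau>_def)
  define L where "L s1 s2 z = (\<Sum>i<n. llr \<sigma> \<tau> (\<gamma>2 * g2 s2 i + fst (snd z) i) (fst (snd z) i))"
    for s1 s2 :: nat and z :: "(nat \<Rightarrow> real) \<times> (nat \<Rightarrow> real) \<times> (nat \<Rightarrow> real)"
  let ?q = "\<lambda>y. \<Prod>i<n. ennreal (normal_density 0 \<tau> (y i))"
  have q1: "(\<integral>\<^sup>+y. ?q y \<partial>lebV n) = 1"
    using nn_integral_shifted_density[OF tau_pos] .
  have kernel: "(\<integral>\<^sup>+z. ennreal (exp (- L s1 s2 z)) * w (Y2 s2 z) \<partial>N) = (\<integral>\<^sup>+y. ?q y * w y \<partial>lebV n)"
    if w [measurable]: "w \<in> borel_measurable (PiM {..<n} (\<lambda>_. borel))" for w :: "(nat \<Rightarrow> real) \<Rightarrow> ennreal" and s1 s2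
  proof -
    have sh: "(\<lambda>z. \<lambda>i\<in>{..<n}. \<gamma>2 * g2 s2 i + z i) \<in> gaussV \<sigma> n \<rightarrow>\<^sub>M PiM {..<n} (\<lambda>_. borel)"
      by measurable
    have "(\<integral>\<^sup>+z. ennreal (exp (- L s1 s2 z)) * w (Y2 s2 z) \<partial>N)
      = (\<integral>\<^sup>+z. (\<lambda>y. ?q y * w y) (\<lambda>i\<in>{..<n}. \<gamma>2 * g2 s2 i + fst (snd z) i)
          * ennreal (\<Prod>i<n. 1 / normal_density 0 \<sigma> (fst (snd z) i)) \<partial>N)"
      unfolding L_def exp_minus_sum_llr[OF sigma_pos tau_pos] sigY2_def
      by (intro nn_integral_cong) (simp add: ennreal_mult' prod_nonneg prod_ennreal mult_ac)
    also have "\<dots> = (\<integral>\<^sup>+z. (\<lambda>y. ?q y * w y) (\<lambda>i\<in>{..<n}. \<gamma>2 * g2 s2 i + z i)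
          * ennreal (\<Prod>i<n. 1 / normal_density 0 \<sigma> (z i)) \<partial>gaussV \<sigma> n)"
      by (rule nn_integral_noiseM_2[OF sigma_pos,
          where h="\<lambda>z. (\<lambda>y. ?q y * w y) (\<lambda>i\<in>{..<n}. \<gamma>2 * g2 s2 i + z i)
            * ennreal (\<Prod>i<n. 1 / normal_density 0 \<sigma> (z i))"])
         (intro borel_measurable_times_ennreal measurable_compose[OF sh], measurable)
    also have "\<dots> = (\<integral>\<^sup>+y. ?q y * w y \<partial>lebV n)"
      by (rule nn_integral_gaussV_unnormalize[OF sigma_pos]) measurable
    finally show ?thesis .
  qed
  have "(1 - \<epsilon>) * ln (real M2) \<le> real n * ln (\<tau> / \<sigma>) + ln 2"
  proof (rule fano[of "real M2" L])
    show "1 \<le> real M2" using M2_pos by simp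
    note u = noiseM_integral_2[OF sigma_pos gaussV_shifted_second_moment(1)[OF sigma_pos]]
    note z = noiseM_integral_2[OF sigma_pos gaussV_component_moments(3)[OF sigma_pos]]
    have val: "integrable N (L s1 s2)" "(\<integral>z. L s1 s2 z \<partial>N) = real n * ln (\<tau> / \<sigma>)
        + (\<Sum>i<n. (\<gamma>2 * g2 s2 i)\<^sup>2 + \<sigma>\<^sup>2) / (2 * \<tau>\<^sup>2) - real n / 2" for s1 s2
      using integral_sum_llr[OF prob_space_N sigma_pos tau_pos, of n
          "\<lambda>i z. \<gamma>2 * g2 s2 i + fst (snd z) i" "\<lambda>i z. fst (snd z) i"]
      unfolding L_def
      by (simp_all add: u z gaussV_shifted_second_moment[OF sigma_pos] gaussV_component_moments[OF sigma_pos])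
    show "integrable N (L s1 s2)" for s1 s2 by (rule val)
    show "(\<integral>\<^sup>+z. ennreal (exp (- L s1 s2 z)) \<partial>N) = 1" for s1 s2
      using kernel[of "\<lambda>_. 1" s1 s2] q1 by simp
    \<comment> \<open>For fixed \<open>s1\<close> the success of \<open>d2\<close> is forgotten; the
      regions of \<open>d1 s1\<close> are disjoint and the reference is the same for all
      \<open>s2\<close>, so each \<open>s1\<close> contributes at most 1.\<close>
    have "(\<Sum>s2<M2. \<integral>\<^sup>+z. ennreal (exp (- L s1 s2 z)) * indicator (good s1 s2) z \<partial>N) \<le> 1" for s1
    proof -
      have "(\<integral>\<^sup>+z. ennreal (exp (- L s1 s2 z)) * indicator (good s1 s2) z \<partial>N)
          \<le> (\<integral>\<^sup>+z. ennreal (exp (- L s1 s2 z)) * indicator {s2} (d1 s1 (Y2 s2 z)) \<partial>N)" for s2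
        by (intro nn_integral_mono mult_left_mono) (auto simp: good_def indicator_def)
      also have "\<dots> s2 = (\<integral>\<^sup>+y. ?q y * indicator {s2} (d1 s1 y) \<partial>lebV n)" for s2
        by (rule kernel[of "\<lambda>y. indicator {s2} (d1 s1 y)"]) measurable
      finally have "(\<Sum>s2<M2. \<integral>\<^sup>+z. ennreal (exp (- L s1 s2 z)) * indicator (good s1 s2) z \<partial>N)
          \<le> (\<Sum>s2<M2. \<integral>\<^sup>+y. ?q y * indicator {s2} (d1 s1 y) \<partial>lebV n)"
        by (intro sum_mono)
      also have "\<dots> = (\<integral>\<^sup>+y. (\<Sum>s2<M2. ?q y * indicator {s2} (d1 s1 y)) \<partial>lebV n)"
        by (rule nn_integral_sum[symmetric]) measurable
      also have "\<dots> \<le> (\<integral>\<^sup>+y. ?q y \<partial>lebV n)"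
        by (intro nn_integral_mono sum_mult_indicator_singleton_le)
      finally show ?thesis by (simp add: q1)
    qed
    then have "(\<Sum>s1<M1. \<Sum>s2<M2. \<integral>\<^sup>+z. ennreal (exp (- L s1 s2 z)) * indicator (good s1 s2) z \<partial>N)
        \<le> (\<Sum>s1<M1. 1)"
      by (intro sum_mono)
    then show "(\<Sum>s1<M1. \<Sum>s2<M2. \<integral>\<^sup>+z. ennreal (exp (- L s1 s2 z)) * indicator (good s1 s2) z \<partial>N)
        \<le> ennreal (real M1 * real M2 / real M2)"
      using M2_pos by (simp add: ennreal_of_nat_eq_real_of_nat)
    have "(\<Sum>s\<in>S. \<Sum>i<n. (\<gamma>2 * g2 (snd s) i)\<^sup>2 + \<sigma>\<^sup>2) = card S * (real n * \<tau>\<^sup>2)"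
      unfolding tau2 using sum_g2
      by (simp add: sum.cartesian_product' sum.distrib power_mult_distrib sum_distrib_left[symmetric] algebra_simps)
    from average_llr_le[OF tau_pos, of "\<lambda>s. \<Sum>i<n. (\<gamma>2 * g2 (snd s) i)\<^sup>2 + \<sigma>\<^sup>2" S n, OF eq_refl[OF this]]
    show "(\<Sum>s1<M1. \<Sum>s2<M2. \<integral>z. L s1 s2 z \<partial>N) \<le> real M1 * real M2 * (real n * ln (\<tau> / \<sigma>))"
      by (simp add: val sum.cartesian_product')
  qed
  also have "ln (\<tau> / \<sigma>) = ln ((\<sigma>\<^sup>2 + \<gamma>2\<^sup>2 * p2) / \<sigma>\<^sup>2) / 2"
    unfolding tau2[symmetric] using tau_pos sigma_pos
    by (simp add: power_divide[symmetric] ln_realpow)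
  finally show ?thesis by simp
qed

text \<open>Given \<open>s2\<close> the interference is a known mean and costs nothing. The noises
  in Y2 and Y3 keep their true law, and conditionally on them X1 is a fixed translation.\<close>

lemma rate1_bound:
  "(1 - \<epsilon>) * ln M1 \<le> real n / 2 * ln ((\<sigma>\<^sup>2 + \<gamma>1\<^sup>2 * P1) / \<sigma>\<^sup>2) + ln 2"
proof -
  define \<tau> where "\<tau> = sqrt (\<sigma>\<^sup>2 + \<gamma>1\<^sup>2 * P1)"
  have vpos: "\<sigma>\<^sup>2 + \<gamma>1\<^sup>2 * P1 > 0"
    using sigma_pos P1_nonneg by (intro add_pos_nonneg) auto
  then have tau_pos: "\<tau> > 0" and tau2: "\<tau>\<^sup>2 = \<sigma>\<^sup>2 + \<gamma>1\<^sup>2 * P1"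
    by (auto simp: \<tau>_def)
  let ?Q = "gaussV \<sigma> n \<Otimes>\<^sub>M gaussV \<sigma> k"
  interpret Q: prob_space ?Q by (intro prob_space_pair prob_space_gaussV sigma_pos)
  define L where "L s1 s2 z = (\<Sum>i<n. llr \<sigma> \<tau> (\<gamma>1 * X s1 s2 i (fst (snd z)) + fst z i) (fst z i))"
    for s1 s2 :: nat and z :: "(nat \<Rightarrow> real) \<times> (nat \<Rightarrow> real) \<times> (nat \<Rightarrow> real)"
  \<comment> \<open>The mean retains the interfering codeword, as if it were revealed to M2; so
    \<open>\<tau>\<close> accounts only for \<open>P1\<close> and the noise.\<close>
  let ?q = "\<lambda>s2 y. \<Prod>i<n. ennreal (normal_density (\<gamma>m * g2 s2 i) \<tau> (y i))"
  have q1: "(\<integral>\<^sup>+y. ?q s2 y \<partial>lebV n) = 1" for s2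
    using nn_integral_shifted_density[OF tau_pos] .
  have kernel: "(\<integral>\<^sup>+z. ennreal (exp (- L s1 s2 z)) * w (Y1 s1 s2 z, snd z) \<partial>N)
      = (\<integral>\<^sup>+b. \<integral>\<^sup>+y. ?q s2 y * w (y, b) \<partial>lebV n \<partial>?Q)"
    if w [measurable]: "w \<in> borel_measurable (PiM {..<n} (\<lambda>_. borel) \<Otimes>\<^sub>M ?Q)"
    for w :: "_ \<Rightarrow> ennreal" and s1 s2
  proof -
    have dens: "normal_density (\<gamma>m * g2 s2 i) \<tau> (\<gamma>1 * x + \<gamma>m * g2 s2 i + z)
        = normal_density 0 \<tau> (\<gamma>1 * x + z)" for i x z
      by (simp add: normal_density_def algebra_simps)
    have "(\<integral>\<^sup>+z. ennreal (exp (- L s1 s2 z)) * w (Y1 s1 s2 z, snd z) \<partial>N)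
      = (\<integral>\<^sup>+z. (\<lambda>p. ?q s2 (fst p) * w p)
            (\<lambda>i\<in>{..<n}. (\<gamma>1 * X s1 s2 i (fst (snd z)) + \<gamma>m * g2 s2 i) + fst z i, snd z)
          * ennreal (\<Prod>i<n. 1 / normal_density 0 \<sigma> (fst z i)) \<partial>N)"
      unfolding L_def exp_minus_sum_llr[OF sigma_pos tau_pos] sigY1_eq
      by (intro nn_integral_cong) (simp add: dens ennreal_mult' prod_nonneg prod_ennreal mult_ac)
    also have "\<dots> = (\<integral>\<^sup>+b. \<integral>\<^sup>+y. (\<lambda>p. ?q s2 (fst p) * w p) (y, b) \<partial>lebV n \<partial>?Q)"
      unfolding noiseM_def
      by (rule nn_integral_pair_unnormalize[OF sigma_pos Q.prob_space_axioms,
          where t="\<lambda>b i. \<gamma>1 * X s1 s2 i (fst b) + \<gamma>m * g2 s2 i"]) measurable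
    finally show ?thesis by simp
  qed
  have "(1 - \<epsilon>) * ln (real M1) \<le> real n * ln (\<tau> / \<sigma>) + ln 2"
  proof (rule fano[of "real M1" L])
    show "1 \<le> real M1" using M1_pos by simp
    note z = noiseM_integral_1[OF sigma_pos gaussV_component_moments(3)[OF sigma_pos]]
    have u: "integrable N (\<lambda>z. (\<gamma>1 * X s1 s2 i (fst (snd z)) + fst z i)\<^sup>2)"
      "(\<integral>z. (\<gamma>1 * X s1 s2 i (fst (snd z)) + fst z i)\<^sup>2 \<partial>N) = \<gamma>1\<^sup>2 * (\<integral>z. (X s1 s2 i z)\<^sup>2 \<partial>gaussV \<sigma> n) + \<sigma>\<^sup>2"
      if "s1 < M1" "s2 < M2" "i < n" for s1 s2 i
    proof -
      have "integrable (gaussV \<sigma> n) (\<lambda>z. (\<gamma>1 * X s1 s2 i z)\<^sup>2)"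
        using X_power(1)[OF that] by (simp add: power_mult_distrib)
      from noiseM_second_moment_add[OF sigma_pos that(3) this, of k 1]
      show "integrable N (\<lambda>z. (\<gamma>1 * X s1 s2 i (fst (snd z)) + fst z i)\<^sup>2)"
        "(\<integral>z. (\<gamma>1 * X s1 s2 i (fst (snd z)) + fst z i)\<^sup>2 \<partial>N) = \<gamma>1\<^sup>2 * (\<integral>z. (X s1 s2 i z)\<^sup>2 \<partial>gaussV \<sigma> n) + \<sigma>\<^sup>2"
        by (simp_all add: power_mult_distrib)
    qed
    have val: "integrable N (L s1 s2)" "(\<integral>z. L s1 s2 z \<partial>N) = real n * ln (\<tau> / \<sigma>)
        + (\<Sum>i<n. \<gamma>1\<^sup>2 * (\<integral>z. (X s1 s2 i z)\<^sup>2 \<partial>gaussV \<sigma> n) + \<sigma>\<^sup>2) / (2 * \<tau>\<^sup>2) - real n / 2"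
      if "s1 < M1" "s2 < M2" for s1 s2
      using integral_sum_llr[OF prob_space_N sigma_pos tau_pos, of n
          "\<lambda>i z. \<gamma>1 * X s1 s2 i (fst (snd z)) + fst z i" "\<lambda>i z. fst z i"]
      unfolding L_def
      by (simp_all add: u[OF that] z gaussV_component_moments[OF sigma_pos])
    show "integrable N (L s1 s2)" if "s1 < M1" "s2 < M2" for s1 s2 by (rule val[OF that])
    show "(\<integral>\<^sup>+z. ennreal (exp (- L s1 s2 z)) \<partial>N) = 1" for s1 s2
      using kernel[of "\<lambda>_. 1" s1 s2] by (simp add: q1 Q.emeasure_space_1)
    \<comment> \<open>With \<open>s2\<close> fixed, neither the reference law of Y1 nor Y3 depends
      on \<open>s1\<close>; hence the sum now runs over \<open>s1\<close> inside, and success of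
      \<open>d1\<close> is the part that is dropped.\<close>
    have "(\<Sum>s1<M1. \<integral>\<^sup>+z. ennreal (exp (- L s1 s2 z)) * indicator (good s1 s2) z \<partial>N) \<le> 1" for s2
    proof -
      have "(\<integral>\<^sup>+z. ennreal (exp (- L s1 s2 z)) * indicator (good s1 s2) z \<partial>N)
          \<le> (\<integral>\<^sup>+z. ennreal (exp (- L s1 s2 z)) * indicator {s1} (d2 (Y1 s1 s2 z) (Y3 s2 z)) \<partial>N)" for s1
        by (intro nn_integral_mono mult_left_mono) (auto simp: good_def indicator_def)
      also have "\<dots> s1 = (\<integral>\<^sup>+b. \<integral>\<^sup>+y. ?q s2 y * indicator {s1} (d2 y (sigY3 \<gamma>s k (g3 s2) (snd b))) \<partial>lebV n \<partial>?Q)" for s1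
      proof -
        have "(\<lambda>p. d2 (fst p) (sigY3 \<gamma>s k (g3 s2) (snd (snd p)))) \<in> PiM {..<n} (\<lambda>_. borel) \<Otimes>\<^sub>M ?Q \<rightarrow>\<^sub>M count_space UNIV"
          by (intro d2_compose_measurable measurable_fst
              measurable_compose[OF measurable_compose[OF measurable_snd measurable_snd] sigY3_measurable])
        from measurable_compose[OF this, of "indicator {s1}" "borel :: ennreal measure"]
        show ?thesis
          using kernel[of "\<lambda>p. indicator {s1} (d2 (fst p) (sigY3 \<gamma>s k (g3 s2) (snd (snd p))))" s1 s2] by simp
      qed
      finally have "(\<Sum>s1<M1. \<integral>\<^sup>+z. ennreal (exp (- L s1 s2 z)) * indicator (good s1 s2) z \<partial>N)
          \<le> (\<Sum>s1<M1. \<integral>\<^sup>+b. \<integral>\<^sup>+y. ?q s2 y * indicator {s1} (d2 y (sigY3 \<gamma>s k (g3 s2) (snd b))) \<partial>lebV n \<partial>?Q)"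
        by (intro sum_mono)
      also have "\<dots> = (\<integral>\<^sup>+b. (\<Sum>s1<M1. \<integral>\<^sup>+y. ?q s2 y * indicator {s1} (d2 y (sigY3 \<gamma>s k (g3 s2) (snd b))) \<partial>lebV n) \<partial>?Q)"
      proof (rule nn_integral_sum[symmetric])
        interpret sigma_finite_measure "lebV n" by (rule sigma_finite_lebV)
        show "(\<lambda>b. \<integral>\<^sup>+y. ?q s2 y * indicator {s1} (d2 y (sigY3 \<gamma>s k (g3 s2) (snd b))) \<partial>lebV n)
            \<in> borel_measurable ?Q" for s1
          by measurable
      qed
      also have "\<dots> \<le> (\<integral>\<^sup>+b. 1 \<partial>?Q)"
      proof (rule nn_integral_mono)
        fix b assume [simp]: "b \<in> space ?Q"
        have [measurable]: "(\<lambda>y. d2 y (sigY3 \<gamma>s k (g3 s2) (snd b))) \<in> lebV n \<rightarrow>\<^sub>M count_space UNIV"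
          by (rule d2_compose_measurable) (auto intro!: measurable_const simp: sigY3_def space_PiM)
        have "(\<Sum>s1<M1. \<integral>\<^sup>+y. ?q s2 y * indicator {s1} (d2 y (sigY3 \<gamma>s k (g3 s2) (snd b))) \<partial>lebV n)
          = (\<integral>\<^sup>+y. (\<Sum>s1<M1. ?q s2 y * indicator {s1} (d2 y (sigY3 \<gamma>s k (g3 s2) (snd b)))) \<partial>lebV n)"
          by (rule nn_integral_sum[symmetric]) measurable
        also have "\<dots> \<le> (\<integral>\<^sup>+y. ?q s2 y \<partial>lebV n)"
          by (intro nn_integral_mono sum_mult_indicator_singleton_le)
        finally show "(\<Sum>s1<M1. \<integral>\<^sup>+y. ?q s2 y * indicator {s1} (d2 y (sigY3 \<gamma>s k (g3 s2) (snd b))) \<partial>lebV n) \<le> 1"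
          by (simp add: q1)
      qed
      finally show ?thesis by (simp add: Q.emeasure_space_1)
    qed
    then have "(\<Sum>s2<M2. \<Sum>s1<M1. \<integral>\<^sup>+z. ennreal (exp (- L s1 s2 z)) * indicator (good s1 s2) z \<partial>N)
        \<le> (\<Sum>s2<M2. 1)"
      by (intro sum_mono)
    then show "(\<Sum>s1<M1. \<Sum>s2<M2. \<integral>\<^sup>+z. ennreal (exp (- L s1 s2 z)) * indicator (good s1 s2) z \<partial>N)
        \<le> ennreal (real M1 * real M2 / real M1)"
      using M1_pos by (subst sum.swap) (simp add: ennreal_of_nat_eq_real_of_nat)
    define V where "V s = (\<Sum>i<n. \<gamma>1\<^sup>2 * (\<integral>z. (X (fst s) (snd s) i z)\<^sup>2 \<partial>gaussV \<sigma> n) + \<sigma>\<^sup>2)" for s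
    have "(\<Sum>s\<in>S. V s) = \<gamma>1\<^sup>2 * (\<Sum>s1<M1. \<Sum>s2<M2. \<Sum>i<n. \<integral>z. (X s1 s2 i z)\<^sup>2 \<partial>gaussV \<sigma> n)
        + real M1 * real M2 * real n * \<sigma>\<^sup>2"
      unfolding V_def by (simp add: sum.cartesian_product' sum.distrib sum_distrib_left)
    also have "\<dots> \<le> \<gamma>1\<^sup>2 * (real M1 * real M2 * real n * P1) + real M1 * real M2 * real n * \<sigma>\<^sup>2"
      by (intro add_right_mono mult_left_mono X_power(2)) auto
    also have "\<dots> = card S * (real n * \<tau>\<^sup>2)"
      unfolding tau2 by (simp add: algebra_simps)
    finally have "(\<Sum>s\<in>S. real n * ln (\<tau> / \<sigma>) + V s / (2 * \<tau>\<^sup>2) - real n / 2) \<le> card S * (real n * ln (\<tau> / \<sigma>))"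
      by (rule average_llr_le[OF tau_pos])
    then show "(\<Sum>s1<M1. \<Sum>s2<M2. \<integral>z. L s1 s2 z \<partial>N) \<le> real M1 * real M2 * (real n * ln (\<tau> / \<sigma>))"
      by (simp add: val V_def sum.cartesian_product')
  qed
  also have "ln (\<tau> / \<sigma>) = ln ((\<sigma>\<^sup>2 + \<gamma>1\<^sup>2 * P1) / \<sigma>\<^sup>2) / 2"
    unfolding tau2[symmetric] using tau_pos sigma_pos
    by (simp add: power_divide[symmetric] ln_realpow)
  finally show ?thesis by simp
qed

end

text \<open>The left side is the variance of the residual when a x + z2 is estimated by the linear
  least-squares multiple of b x + z1, with x of power \<open>p\<close> and noises of variance
  \<open>s\<close>. The right side displays the factor 1 + SNR2 / (1 + INR).\<close>

lemma mmse_identity: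
  fixes a b p s :: real
  assumes "b\<^sup>2 * p + s \<noteq> 0"
  shows "(a - a * b * p / (b\<^sup>2 * p + s) * b)\<^sup>2 * p + s * (1 + (a * b * p / (b\<^sup>2 * p + s))\<^sup>2)
    = s * (1 + a\<^sup>2 * p / (b\<^sup>2 * p + s))"
proof -
  define D where "D = b\<^sup>2 * p + s"
  have D: "D \<noteq> 0" and s: "s = D - b\<^sup>2 * p" using assms by (simp_all add: D_def)
  have "(a - a * b * p / D * b)\<^sup>2 * p + s * (1 + (a * b * p / D)\<^sup>2) = s * (1 + a\<^sup>2 * p / D)"
    using D unfolding s by (simp add: field_simps) (simp add: power2_eq_square power4_eq_xxxx algebra_simps)
  then show ?thesis by (simp add: D_def)
qed

section \<open>The sum rate in the presence of feedback\<close>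

context full_duplex_code
begin

text \<open>The log likelihood ratio splits into one summand per output Y1, Y2, Y3, and each
  produces one term. The standard deviation \<open>\<tau>3\<close> stays free because its best
  choice depends on how much of the side channel the code uses.\<close>

lemma sum_rate_bound:
  assumes tau3: "\<tau>3 > 0"
  shows "(1 - \<epsilon>) * ln (real M1 * real M2)
    \<le> real n / 2 * ln ((\<sigma>\<^sup>2 + 2 * \<gamma>1\<^sup>2 * P1 + 2 * \<gamma>m\<^sup>2 * p2) / \<sigma>\<^sup>2)
      + real n / 2 * ln (1 + \<gamma>2\<^sup>2 * p2 / (\<gamma>m\<^sup>2 * p2 + \<sigma>\<^sup>2))
      + (real k * ln (\<tau>3 / \<sigma>) + (real k * \<sigma>\<^sup>2 + real n * \<gamma>s\<^sup>2 * p3) / (2 * \<tau>3\<^sup>2) - real k / 2) + ln 2"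
proof -
  \<comment> \<open>The factors 2 bound the power of \<gamma>1 X1 + \<gamma>m X2 without any
    assumption on the correlation that feedback creates.\<close>
  define \<tau>1 where "\<tau>1 = sqrt (\<sigma>\<^sup>2 + 2 * \<gamma>1\<^sup>2 * P1 + 2 * \<gamma>m\<^sup>2 * p2)"
  have Dpos: "\<gamma>m\<^sup>2 * p2 + \<sigma>\<^sup>2 > 0"
    using sigma_pos p2_nonneg by (intro add_nonneg_pos) auto
  have v1: "\<sigma>\<^sup>2 + 2 * \<gamma>1\<^sup>2 * P1 + 2 * \<gamma>m\<^sup>2 * p2 > 0"
    using sigma_pos p2_nonneg P1_nonneg by (intro add_pos_nonneg) auto
  then have tau1: "\<tau>1 > 0" "\<tau>1\<^sup>2 = \<sigma>\<^sup>2 + 2 * \<gamma>1\<^sup>2 * P1 + 2 * \<gamma>m\<^sup>2 * p2"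
    by (auto simp: \<tau>1_def)
  define \<tau>2 where "\<tau>2 = sqrt (\<sigma>\<^sup>2 * (1 + \<gamma>2\<^sup>2 * p2 / (\<gamma>m\<^sup>2 * p2 + \<sigma>\<^sup>2)))"
  have v2: "\<sigma>\<^sup>2 * (1 + \<gamma>2\<^sup>2 * p2 / (\<gamma>m\<^sup>2 * p2 + \<sigma>\<^sup>2)) > 0"
    using sigma_pos p2_nonneg Dpos by (intro mult_pos_pos add_pos_nonneg) auto
  then have tau2: "\<tau>2 > 0" "\<tau>2\<^sup>2 = \<sigma>\<^sup>2 * (1 + \<gamma>2\<^sup>2 * p2 / (\<gamma>m\<^sup>2 * p2 + \<sigma>\<^sup>2))"
    by (auto simp: \<tau>2_def)
  \<comment> \<open>The least-squares coefficient for estimating \<gamma>2 X2 from \<gamma>m X2 + Z1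
    at power \<open>p2\<close>.\<close>
  define \<alpha> where "\<alpha> = \<gamma>2 * \<gamma>m * p2 / (\<gamma>m\<^sup>2 * p2 + \<sigma>\<^sup>2)"
  have tau2': "\<tau>2\<^sup>2 = (\<gamma>2 - \<alpha> * \<gamma>m)\<^sup>2 * p2 + \<sigma>\<^sup>2 * (1 + \<alpha>\<^sup>2)"
    unfolding tau2 \<alpha>_def using Dpos by (intro mmse_identity[symmetric]) simp
  define A where "A s1 s2 z = (\<Sum>i<n. llr \<sigma> \<tau>1 ((\<gamma>1 * X s1 s2 i (fst (snd z)) + \<gamma>m * g2 s2 i) + fst z i) (fst z i))"
    for s1 s2 :: nat and z :: "(nat \<Rightarrow> real) \<times> (nat \<Rightarrow> real) \<times> (nat \<Rightarrow> real)"
  \<comment> \<open>The argument equals Y2 - \<alpha> (Y1 - \<gamma>1 X1). Here X1 cancels, so the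
    term depends on neither \<open>s1\<close> nor the feedback and its second moment can be computed
    exactly.\<close>
  define B where "B s2 z = (\<Sum>i<n. llr \<sigma> \<tau>2 (((\<gamma>2 - \<alpha> * \<gamma>m) * g2 s2 i + fst (snd z) i) + (- \<alpha>) * fst z i) (fst (snd z) i))"
    for s2 :: nat and z :: "(nat \<Rightarrow> real) \<times> (nat \<Rightarrow> real) \<times> (nat \<Rightarrow> real)"
  define C where "C s2 z = (\<Sum>j<k. llr \<sigma> \<tau>3 (\<gamma>s * g3 s2 j + snd (snd z) j) (snd (snd z) j))"
    for s2 :: nat and z :: "(nat \<Rightarrow> real) \<times> (nat \<Rightarrow> real) \<times> (nat \<Rightarrow> real)"
  define L where "L s1 s2 z = A s1 s2 z + B s2 z + C s2 z" for s1 s2 z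
  define q1 where "q1 y = (\<Prod>i<n. ennreal (normal_density 0 \<tau>1 (y i)))" for y
  define q3 where "q3 y = (\<Prod>j<k. ennreal (normal_density 0 \<tau>3 (y j)))" for y
  \<comment> \<open>The reference draws Y2 after the whole of Y1. The mean at time i uses X1 at time
    i, hence only earlier values of \<open>y2\<close>, so this is a causal density for every fixed
    \<open>y1\<close>. It contains \<open>s1\<close> but not \<open>s2\<close>.\<close>
  define q2 where "q2 s1 y1 y2 = (\<Prod>i<n. ennreal (normal_density (\<alpha> * (y1 i - \<gamma>1 * f1 s1 i y2)) \<tau>2 (y2 i)))"
    for s1 y1 y2
  have q1m [measurable]: "q1 \<in> borel_measurable (PiM {..<n} (\<lambda>_. borel))"
    unfolding q1_def by measurable
  have q3m [measurable]: "q3 \<in> borel_measurable (PiM {..<k} (\<lambda>_. borel))"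
    unfolding q3_def by measurable
  have q2m: "(\<lambda>p. q2 s1 (fst p) (snd p)) \<in> borel_measurable (PiM {..<n} (\<lambda>_. borel) \<Otimes>\<^sub>M PiM {..<n} (\<lambda>_. borel))" for s1
    unfolding q2_def normal_density_def by measurable
  have q2m' [measurable (raw)]: "(\<lambda>x. q2 s1 (a x) (b x)) \<in> borel_measurable Q"
    if "a \<in> Q \<rightarrow>\<^sub>M PiM {..<n} (\<lambda>_. borel)" "b \<in> Q \<rightarrow>\<^sub>M PiM {..<n} (\<lambda>_. borel)" for Q a b and s1
    using measurable_compose[OF measurable_Pair[OF that] q2m] by simp
  have q1_1: "(\<integral>\<^sup>+y. q1 y \<partial>lebV n) = 1"
    unfolding q1_def by (rule nn_integral_shifted_density[OF tau1(1)])
  have q3_1: "(\<integral>\<^sup>+y. q3 y \<partial>lebV k) = 1"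
    unfolding q3_def by (rule nn_integral_shifted_density[OF tau3])
  have q2_1: "(\<integral>\<^sup>+y2. q2 s1 y1 y2 \<partial>lebV n) = 1" for s1 y1
    unfolding q2_def
  proof (rule nn_integral_causal_density[OF tau2(1)])
    show "\<alpha> * (y1 i - \<gamma>1 * f1 s1 i y) = \<alpha> * (y1 i - \<gamma>1 * f1 s1 i y')" if "\<And>j. j < i \<Longrightarrow> y j = y' j" for i y y'
      using causal[OF that] by simp
  qed measurable
  have sg: "(\<lambda>i\<in>{..<n}. \<gamma>2 * g2 s2 i + z i) = sigY2 \<gamma>2 n (g2 s2) z"
    "(\<lambda>j\<in>{..<k}. \<gamma>s * g3 s2 j + z j) = sigY3 \<gamma>s k (g3 s2) z" for s2 z
    by (auto simp: sigY2_def sigY3_def)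
  have kernel: "(\<integral>\<^sup>+z. ennreal (exp (- L s1 s2 z)) * w (Y1 s1 s2 z, Y2 s2 z, Y3 s2 z) \<partial>N)
      = (\<integral>\<^sup>+y3. \<integral>\<^sup>+y2. \<integral>\<^sup>+y1. q1 y1 * q2 s1 y1 y2 * q3 y3 * w (y1, y2, y3) \<partial>lebV n \<partial>lebV n \<partial>lebV k)"
    if w [measurable]: "w \<in> borel_measurable (PiM {..<n} (\<lambda>_. borel) \<Otimes>\<^sub>M PiM {..<n} (\<lambda>_. borel) \<Otimes>\<^sub>M PiM {..<k} (\<lambda>_. borel))"
    for w :: "_ \<Rightarrow> ennreal" and s1 s2
  proof -
    let ?F = "\<lambda>p. q1 (fst p) * q2 s1 (fst p) (fst (snd p)) * q3 (snd (snd p)) * w p"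
    have "ennreal (exp (- L s1 s2 z)) = q1 (Y1 s1 s2 z) * q2 s1 (Y1 s1 s2 z) (Y2 s2 z) * q3 (Y3 s2 z)
        * (ennreal (\<Prod>i<n. 1 / normal_density 0 \<sigma> (fst z i))
        * ennreal (\<Prod>i<n. 1 / normal_density 0 \<sigma> (fst (snd z) i))
        * ennreal (\<Prod>j<k. 1 / normal_density 0 \<sigma> (snd (snd z) j)))" for z
    proof -
      have "exp (- L s1 s2 z) = exp (- A s1 s2 z) * exp (- B s2 z) * exp (- C s2 z)"
        by (simp add: L_def exp_add[symmetric])
      moreover have "ennreal (exp (- A s1 s2 z)) = q1 (Y1 s1 s2 z) * ennreal (\<Prod>i<n. 1 / normal_density 0 \<sigma> (fst z i))"
        unfolding A_def exp_minus_sum_llr[OF sigma_pos tau1(1)] q1_def sigY1_eq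
        by (simp add: ennreal_mult' prod_nonneg prod_ennreal)
      moreover have "ennreal (exp (- B s2 z)) = q2 s1 (Y1 s1 s2 z) (Y2 s2 z) * ennreal (\<Prod>i<n. 1 / normal_density 0 \<sigma> (fst (snd z) i))"
      proof -
        have "(\<Prod>i<n. normal_density 0 \<tau>2 (((\<gamma>2 - \<alpha> * \<gamma>m) * g2 s2 i + fst (snd z) i) + (- \<alpha>) * fst z i))
          = (\<Prod>i<n. normal_density (\<alpha> * (Y1 s1 s2 z i - \<gamma>1 * X s1 s2 i (fst (snd z)))) \<tau>2 (Y2 s2 z i))"
          unfolding sigY1_eq
          by (intro prod.cong refl) (simp add: sigY2_def normal_density_def algebra_simps)
        then show ?thesis
          unfolding B_def exp_minus_sum_llr[OF sigma_pos tau2(1)] q2_def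
          by (simp add: ennreal_mult' prod_nonneg prod_ennreal)
      qed
      moreover have "ennreal (exp (- C s2 z)) = q3 (Y3 s2 z) * ennreal (\<Prod>j<k. 1 / normal_density 0 \<sigma> (snd (snd z) j))"
        unfolding C_def exp_minus_sum_llr[OF sigma_pos tau3] q3_def
        by (simp add: ennreal_mult' prod_nonneg prod_ennreal sigY3_def)
      ultimately show ?thesis
        by (simp add: ennreal_mult' mult_ac)
    qed
    then have "(\<integral>\<^sup>+z. ennreal (exp (- L s1 s2 z)) * w (Y1 s1 s2 z, Y2 s2 z, Y3 s2 z) \<partial>N)
      = (\<integral>\<^sup>+z. ?F (Y1 s1 s2 z, Y2 s2 z, Y3 s2 z)
        * (ennreal (\<Prod>i<n. 1 / normal_density 0 \<sigma> (fst z i))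
        * ennreal (\<Prod>i<n. 1 / normal_density 0 \<sigma> (fst (snd z) i))
        * ennreal (\<Prod>j<k. 1 / normal_density 0 \<sigma> (snd (snd z) j))) \<partial>N)"
      by (intro nn_integral_cong) (simp add: mult_ac)
    also have "\<dots> = (\<integral>\<^sup>+y3. \<integral>\<^sup>+y2. \<integral>\<^sup>+y1. ?F (y1, y2, y3) \<partial>lebV n \<partial>lebV n \<partial>lebV k)"
      unfolding sigY1_eq sg[symmetric]
    proof (rule nn_integral_noiseM_unnormalize[OF sigma_pos, where ?t1.0="\<lambda>b i. \<gamma>1 * f1 s1 i (\<lambda>i\<in>{..<n}. \<gamma>2 * g2 s2 i + b i) + \<gamma>m * g2 s2 i"])
      show "?F \<in> borel_measurable (lebV n \<Otimes>\<^sub>M lebV n \<Otimes>\<^sub>M lebV k)"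
        by measurable
    qed measurable
    finally show ?thesis by simp
  qed
  \<comment> \<open>The factor \<open>q2\<close> depends on \<open>y1\<close>, so the integrals are
    swapped and \<open>y2\<close> is integrated first. Its mass is one, and with it the only
    dependence of the reference on \<open>s1\<close> disappears.\<close>
  have norm3: "(\<integral>\<^sup>+y3. \<integral>\<^sup>+y2. \<integral>\<^sup>+y1. q1 y1 * q2 s1 y1 y2 * q3 y3 * v y1 y3 \<partial>lebV n \<partial>lebV n \<partial>lebV k)
      = (\<integral>\<^sup>+y3. q3 y3 * (\<integral>\<^sup>+y1. q1 y1 * v y1 y3 \<partial>lebV n) \<partial>lebV k)"
    if v: "(\<lambda>p. v (fst p) (snd p)) \<in> borel_measurable (PiM {..<n} (\<lambda>_. borel) \<Otimes>\<^sub>M PiM {..<k} (\<lambda>_. borel))"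
    for s1 :: nat and v :: "(nat \<Rightarrow> real) \<Rightarrow> (nat \<Rightarrow> real) \<Rightarrow> ennreal"
  proof (rule nn_integral_cong)
    fix y3 assume y3: "y3 \<in> space (lebV k)"
    interpret sigma_finite_measure "lebV n" by (rule sigma_finite_lebV)
    interpret P: pair_sigma_finite "lebV n" "lebV n" ..
    have [measurable]: "(\<lambda>y1. v y1 y3) \<in> borel_measurable (PiM {..<n} (\<lambda>_. borel))"
    proof -
      have "y3 \<in> space (PiM {..<k} (\<lambda>_. borel :: real measure))"
        using y3 by (simp add: space_PiM)
      from measurable_compose[OF measurable_Pair2'[OF this] v] show ?thesis by simp
    qed
    have "(\<integral>\<^sup>+y2. \<integral>\<^sup>+y1. q1 y1 * q2 s1 y1 y2 * q3 y3 * v y1 y3 \<partial>lebV n \<partial>lebV n)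
      = (\<integral>\<^sup>+y1. \<integral>\<^sup>+y2. q1 y1 * q2 s1 y1 y2 * q3 y3 * v y1 y3 \<partial>lebV n \<partial>lebV n)"
      by (rule P.Fubini') measurable
    also have "\<dots> = (\<integral>\<^sup>+y1. q3 y3 * (q1 y1 * v y1 y3) \<partial>lebV n)"
    proof (rule nn_integral_cong)
      fix y1 assume "y1 \<in> space (lebV n)"
      then have "(\<lambda>_. y1) \<in> lebV n \<rightarrow>\<^sub>M PiM {..<n} (\<lambda>_. borel)" "(\<lambda>y. y) \<in> lebV n \<rightarrow>\<^sub>M PiM {..<n} (\<lambda>_. borel)"
        by (simp_all add: space_PiM)
      from q2m'[OF this] have [measurable]: "q2 s1 y1 \<in> borel_measurable (lebV n)" .
      have "(\<integral>\<^sup>+y2. q1 y1 * q2 s1 y1 y2 * q3 y3 * v y1 y3 \<partial>lebV n)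
        = (\<integral>\<^sup>+y2. (q3 y3 * (q1 y1 * v y1 y3)) * q2 s1 y1 y2 \<partial>lebV n)"
        by (simp add: mult_ac)
      also have "\<dots> = q3 y3 * (q1 y1 * v y1 y3)"
        by (subst nn_integral_cmult) (simp_all add: q2_1)
      finally show "(\<integral>\<^sup>+y2. q1 y1 * q2 s1 y1 y2 * q3 y3 * v y1 y3 \<partial>lebV n) = q3 y3 * (q1 y1 * v y1 y3)" .
    qed
    also have "\<dots> = q3 y3 * (\<integral>\<^sup>+y1. q1 y1 * v y1 y3 \<partial>lebV n)"
      by (rule nn_integral_cmult) measurable
    finally show "(\<integral>\<^sup>+y2. \<integral>\<^sup>+y1. q1 y1 * q2 s1 y1 y2 * q3 y3 * v y1 y3 \<partial>lebV n \<partial>lebV n)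
      = q3 y3 * (\<integral>\<^sup>+y1. q1 y1 * v y1 y3 \<partial>lebV n)" .
  qed
  let ?\<Lambda> = "lebV n \<Otimes>\<^sub>M lebV n \<Otimes>\<^sub>M lebV k"
  \<comment> \<open>A single product measure lets the sum over \<open>s2\<close> pass through one
    integral instead of three nested ones, whose inner integrals would each need a measurability
    proof.\<close>
  have iter: "(\<integral>\<^sup>+y3. \<integral>\<^sup>+y2. \<integral>\<^sup>+y1. F (y1, y2, y3) \<partial>lebV n \<partial>lebV n \<partial>lebV k) = (\<integral>\<^sup>+p. F p \<partial>?\<Lambda>)"
    if F: "F \<in> borel_measurable ?\<Lambda>" for F :: "_ \<Rightarrow> ennreal"
  proof -
    interpret L1: sigma_finite_measure "lebV n" by (rule sigma_finite_lebV)
    interpret L3: sigma_finite_measure "lebV k" by (rule sigma_finite_lebV)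
    interpret P: pair_sigma_finite "lebV n" "lebV k" ..
    interpret Q: pair_sigma_finite "lebV n" "lebV n \<Otimes>\<^sub>M lebV k" ..
    have "(\<integral>\<^sup>+p. F p \<partial>?\<Lambda>) = (\<integral>\<^sup>+b. \<integral>\<^sup>+y1. F (y1, b) \<partial>lebV n \<partial>(lebV n \<Otimes>\<^sub>M lebV k))"
      by (rule Q.nn_integral_snd[OF F, symmetric])
    also have "\<dots> = (\<integral>\<^sup>+y3. \<integral>\<^sup>+y2. \<integral>\<^sup>+y1. F (y1, y2, y3) \<partial>lebV n \<partial>lebV n \<partial>lebV k)"
    proof (rule P.nn_integral_snd[symmetric, where f="\<lambda>b. \<integral>\<^sup>+y1. F (y1, b) \<partial>lebV n"])
      have "(\<lambda>w. F (snd w, fst (fst w), snd (fst w))) \<in> borel_measurable ((lebV n \<Otimes>\<^sub>M lebV k) \<Otimes>\<^sub>M lebV n)"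
        by (rule borel_measurable_rotate[OF F])
      from L1.borel_measurable_nn_integral_fst[OF this]
      show "(\<lambda>b. \<integral>\<^sup>+y1. F (y1, b) \<partial>lebV n) \<in> borel_measurable (lebV n \<Otimes>\<^sub>M lebV k)"
        by simp
    qed
    finally show ?thesis by simp
  qed
  let ?v = "\<lambda>s1 y1 y3. indicator {s1} (d2 y1 y3) :: ennreal"
  let ?q = "\<lambda>s1 p. q1 (fst p) * q2 s1 (fst p) (fst (snd p)) * q3 (snd (snd p))"
  define b where "b = real n * ln (\<tau>1 / \<sigma>) + real n * ln (\<tau>2 / \<sigma>)
      + (real k * ln (\<tau>3 / \<sigma>) + (real k * \<sigma>\<^sup>2 + real n * \<gamma>s\<^sup>2 * p3) / (2 * \<tau>3\<^sup>2) - real k / 2)"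
  have "(1 - \<epsilon>) * ln (real M1 * real M2) \<le> b + ln 2"
  proof (rule fano[of "real M1 * real M2" L])
    show "1 \<le> real M1 * real M2"
      using mult_mono[of 1 "real M1" 1 "real M2"] M1_pos M2_pos by simp
    show "(\<integral>\<^sup>+z. ennreal (exp (- L s1 s2 z)) \<partial>N) = 1" for s1 s2
      using kernel[of "\<lambda>_. 1" s1 s2] norm3[of "\<lambda>_ _. 1" s1] by (simp add: q1_1 q3_1)
    \<comment> \<open>The order of decoding is forced. The reference still knows \<open>s1\<close>,
      so \<open>s2\<close> is guessed first, as at the BS, which knows \<open>S1\<close> too; only
      then does \<open>y2\<close> integrate out and leave a law of Y1 and Y3 that is free of
      \<open>s1\<close>, for which the regions of \<open>d2\<close> are disjoint.\<close>
    have inner: "(\<Sum>s2<M2. \<integral>\<^sup>+z. ennreal (exp (- L s1 s2 z)) * indicator (good s1 s2) z \<partial>N)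
        \<le> (\<integral>\<^sup>+y3. q3 y3 * (\<integral>\<^sup>+y1. q1 y1 * ?v s1 y1 y3 \<partial>lebV n) \<partial>lebV k)" for s1
    proof -
      have "(\<lambda>p. ?v s1 (fst p) (snd (snd p))) \<in> borel_measurable ?\<Lambda>"
        by (intro measurable_indicator_singleton d2_compose_measurable) measurable
      then have m1: "(\<lambda>p. ?q s1 p * ?v s1 (fst p) (snd (snd p))) \<in> borel_measurable ?\<Lambda>"
        by (rule borel_measurable_times_ennreal[rotated]) measurable
      have m2: "(\<lambda>p. (?q s1 p * ?v s1 (fst p) (snd (snd p))) * indicator {s2} (d1 s1 (fst (snd p)))) \<in> borel_measurable ?\<Lambda>" for s2
        by (rule borel_measurable_times_ennreal[OF m1]) measurable
      have "(\<integral>\<^sup>+z. ennreal (exp (- L s1 s2 z)) * indicator (good s1 s2) z \<partial>N)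
          \<le> (\<integral>\<^sup>+z. ennreal (exp (- L s1 s2 z)) *
              (\<lambda>p. ?v s1 (fst p) (snd (snd p)) * indicator {s2} (d1 s1 (fst (snd p)))) (Y1 s1 s2 z, Y2 s2 z, Y3 s2 z) \<partial>N)" for s2
        by (intro nn_integral_mono mult_left_mono) (auto simp: good_def indicator_def)
      also have "\<dots> s2 = (\<integral>\<^sup>+y3. \<integral>\<^sup>+y2. \<integral>\<^sup>+y1. q1 y1 * q2 s1 y1 y2 * q3 y3 *
              (\<lambda>p. ?v s1 (fst p) (snd (snd p)) * indicator {s2} (d1 s1 (fst (snd p)))) (y1, y2, y3) \<partial>lebV n \<partial>lebV n \<partial>lebV k)" for s2
        by (rule kernel) measurable
      also have "\<dots> s2 = (\<integral>\<^sup>+p. (?q s1 p * ?v s1 (fst p) (snd (snd p))) * indicator {s2} (d1 s1 (fst (snd p))) \<partial>?\<Lambda>)" for s2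
        by (subst iter[symmetric, OF m2]) (simp add: mult_ac)
      finally have "(\<Sum>s2<M2. \<integral>\<^sup>+z. ennreal (exp (- L s1 s2 z)) * indicator (good s1 s2) z \<partial>N)
          \<le> (\<Sum>s2<M2. \<integral>\<^sup>+p. (?q s1 p * ?v s1 (fst p) (snd (snd p))) * indicator {s2} (d1 s1 (fst (snd p))) \<partial>?\<Lambda>)"
        by (intro sum_mono)
      also have "\<dots> = (\<integral>\<^sup>+p. (\<Sum>s2<M2. (?q s1 p * ?v s1 (fst p) (snd (snd p))) * indicator {s2} (d1 s1 (fst (snd p)))) \<partial>?\<Lambda>)"
        by (rule nn_integral_sum[symmetric]) measurable
      also have "\<dots> \<le> (\<integral>\<^sup>+p. ?q s1 p * ?v s1 (fst p) (snd (snd p)) \<partial>?\<Lambda>)"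
        by (intro nn_integral_mono sum_mult_indicator_singleton_le)
      also have "\<dots> = (\<integral>\<^sup>+y3. \<integral>\<^sup>+y2. \<integral>\<^sup>+y1. q1 y1 * q2 s1 y1 y2 * q3 y3 * ?v s1 y1 y3 \<partial>lebV n \<partial>lebV n \<partial>lebV k)"
        by (subst iter[symmetric, OF m1]) simp
      also have "\<dots> = (\<integral>\<^sup>+y3. q3 y3 * (\<integral>\<^sup>+y1. q1 y1 * ?v s1 y1 y3 \<partial>lebV n) \<partial>lebV k)"
        by (rule norm3) measurable
      finally show ?thesis .
    qed
    have "(\<Sum>s1<M1. \<integral>\<^sup>+y3. q3 y3 * (\<integral>\<^sup>+y1. q1 y1 * ?v s1 y1 y3 \<partial>lebV n) \<partial>lebV k)
      = (\<integral>\<^sup>+y3. (\<Sum>s1<M1. q3 y3 * (\<integral>\<^sup>+y1. q1 y1 * ?v s1 y1 y3 \<partial>lebV n)) \<partial>lebV k)"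
    proof (rule nn_integral_sum[symmetric])
      interpret sigma_finite_measure "lebV n" by (rule sigma_finite_lebV)
      show "(\<lambda>y3. q3 y3 * (\<integral>\<^sup>+y1. q1 y1 * ?v s1 y1 y3 \<partial>lebV n)) \<in> borel_measurable (lebV k)" for s1
        by measurable
    qed
    also have "\<dots> \<le> (\<integral>\<^sup>+y3. q3 y3 \<partial>lebV k)"
    proof (rule nn_integral_mono)
      fix y3 assume "y3 \<in> space (lebV k)"
      then have [measurable]: "(\<lambda>y1. d2 y1 y3) \<in> lebV n \<rightarrow>\<^sub>M count_space UNIV"
        by (intro d2_compose_measurable) (auto simp: space_PiM)
      have "(\<Sum>s1<M1. \<integral>\<^sup>+y1. q1 y1 * ?v s1 y1 y3 \<partial>lebV n) = (\<integral>\<^sup>+y1. (\<Sum>s1<M1. q1 y1 * ?v s1 y1 y3) \<partial>lebV n)"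
        by (rule nn_integral_sum[symmetric]) measurable
      also have "\<dots> \<le> (\<integral>\<^sup>+y1. q1 y1 \<partial>lebV n)"
        by (intro nn_integral_mono sum_mult_indicator_singleton_le)
      finally have "q3 y3 * (\<Sum>s1<M1. \<integral>\<^sup>+y1. q1 y1 * ?v s1 y1 y3 \<partial>lebV n) \<le> q3 y3 * 1"
        by (intro mult_left_mono) (auto simp: q1_1)
      then show "(\<Sum>s1<M1. q3 y3 * (\<integral>\<^sup>+y1. q1 y1 * ?v s1 y1 y3 \<partial>lebV n)) \<le> q3 y3"
        by (simp add: sum_distrib_left)
    qed
    finally have "(\<Sum>s1<M1. \<Sum>s2<M2. \<integral>\<^sup>+z. ennreal (exp (- L s1 s2 z)) * indicator (good s1 s2) z \<partial>N) \<le> 1"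
      using order_trans[OF sum_mono[OF inner]] by (simp add: q3_1)
    then show "(\<Sum>s1<M1. \<Sum>s2<M2. \<integral>\<^sup>+z. ennreal (exp (- L s1 s2 z)) * indicator (good s1 s2) z \<partial>N)
        \<le> ennreal (real M1 * real M2 / (real M1 * real M2))"
      using M1_pos M2_pos by simp
    note z1 = noiseM_integral_1[OF sigma_pos gaussV_component_moments(3)[OF sigma_pos]]
    note z2 = noiseM_integral_2[OF sigma_pos gaussV_component_moments(3)[OF sigma_pos]]
    note z3 = noiseM_integral_3[OF sigma_pos gaussV_component_moments(3)[OF sigma_pos]]
    note u3 = noiseM_integral_3[OF sigma_pos gaussV_shifted_second_moment(1)[OF sigma_pos]]
    note mom = gaussV_component_moments[OF sigma_pos] gaussV_shifted_second_moment[OF sigma_pos]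
    define VA where "VA s1 s2 = (\<Sum>i<n. (\<integral>z. (\<gamma>1 * X s1 s2 i z + \<gamma>m * g2 s2 i)\<^sup>2 \<partial>gaussV \<sigma> n) + \<sigma>\<^sup>2)" for s1 s2
    define VB where "VB s2 = (\<Sum>i<n. ((\<gamma>2 - \<alpha> * \<gamma>m) * g2 s2 i)\<^sup>2 + \<sigma>\<^sup>2 + \<alpha>\<^sup>2 * \<sigma>\<^sup>2)" for s2
    define VC where "VC s2 = (\<Sum>j<k. (\<gamma>s * g3 s2 j)\<^sup>2 + \<sigma>\<^sup>2)" for s2
    have XI: "integrable (gaussV \<sigma> n) (X s1 s2 i)" if "s1 < M1" "s2 < M2" "i < n" for s1 s2 i
    proof -
      interpret prob_space "gaussV \<sigma> n" by (rule prob_space_gaussV[OF sigma_pos])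
      show ?thesis by (rule square_integrable_imp_integrable[OF X_measurable X_power(1)[OF that]])
    qed
    have sqI: "integrable (gaussV \<sigma> n) (\<lambda>z. (\<gamma>1 * X s1 s2 i z + \<gamma>m * g2 s2 i)\<^sup>2)"
      if "s1 < M1" "s2 < M2" "i < n" for s1 s2 i
    proof -
      interpret prob_space "gaussV \<sigma> n" by (rule prob_space_gaussV[OF sigma_pos])
      show ?thesis
        using X_power(1)[OF that] XI[OF that] by (simp add: power2_sum power_mult_distrib)
    qed
    have uA: "integrable N (\<lambda>z. (\<gamma>1 * X s1 s2 i (fst (snd z)) + \<gamma>m * g2 s2 i + fst z i)\<^sup>2)"
      "(\<integral>z. (\<gamma>1 * X s1 s2 i (fst (snd z)) + \<gamma>m * g2 s2 i + fst z i)\<^sup>2 \<partial>N)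
        = (\<integral>z. (\<gamma>1 * X s1 s2 i z + \<gamma>m * g2 s2 i)\<^sup>2 \<partial>gaussV \<sigma> n) + \<sigma>\<^sup>2"
      if "s1 < M1" "s2 < M2" "i < n" for s1 s2 i
      using noiseM_second_moment_add[OF sigma_pos that(3) sqI[OF that], of k 1] by simp_all
    have valA: "integrable N (A s1 s2)"
      "(\<integral>z. A s1 s2 z \<partial>N) = real n * ln (\<tau>1 / \<sigma>) + VA s1 s2 / (2 * \<tau>1\<^sup>2) - real n / 2"
      if "s1 < M1" "s2 < M2" for s1 s2
      using integral_sum_llr[OF prob_space_N sigma_pos tau1(1), of n
          "\<lambda>i z. \<gamma>1 * X s1 s2 i (fst (snd z)) + \<gamma>m * g2 s2 i + fst z i" "\<lambda>i z. fst z i"]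
      unfolding A_def VA_def by (simp_all add: uA[OF that] z1 mom)
    have uB: "integrable N (\<lambda>z. ((\<gamma>2 - \<alpha> * \<gamma>m) * g2 s2 i + fst (snd z) i + (- \<alpha>) * fst z i)\<^sup>2)"
      "(\<integral>z. ((\<gamma>2 - \<alpha> * \<gamma>m) * g2 s2 i + fst (snd z) i + (- \<alpha>) * fst z i)\<^sup>2 \<partial>N)
        = ((\<gamma>2 - \<alpha> * \<gamma>m) * g2 s2 i)\<^sup>2 + \<sigma>\<^sup>2 + \<alpha>\<^sup>2 * \<sigma>\<^sup>2"
      if "i < n" for s2 i
    proof -
      have m: "(\<lambda>z. (\<gamma>2 - \<alpha> * \<gamma>m) * g2 s2 i + z i) \<in> borel_measurable (gaussV \<sigma> n)"
        by (intro borel_measurable_add borel_measurable_const borel_measurable_integrable mom(1) that)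
      note * = noiseM_second_moment_add[OF sigma_pos that mom(5)[OF that] m, of k "- \<alpha>"]
      show "integrable N (\<lambda>z. ((\<gamma>2 - \<alpha> * \<gamma>m) * g2 s2 i + fst (snd z) i + (- \<alpha>) * fst z i)\<^sup>2)"
        by (rule *(1))
      show "(\<integral>z. ((\<gamma>2 - \<alpha> * \<gamma>m) * g2 s2 i + fst (snd z) i + (- \<alpha>) * fst z i)\<^sup>2 \<partial>N)
        = ((\<gamma>2 - \<alpha> * \<gamma>m) * g2 s2 i)\<^sup>2 + \<sigma>\<^sup>2 + \<alpha>\<^sup>2 * \<sigma>\<^sup>2"
        unfolding *(2) mom(6)[OF that] by simp
    qed
    have valB: "integrable N (B s2)"
      "(\<integral>z. B s2 z \<partial>N) = real n * ln (\<tau>2 / \<sigma>) + VB s2 / (2 * \<tau>2\<^sup>2) - real n / 2" for s2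
    proof -
      have VB: "VB s2 = (\<Sum>i<n. \<integral>z. ((\<gamma>2 - \<alpha> * \<gamma>m) * g2 s2 i + fst (snd z) i + (- \<alpha>) * fst z i)\<^sup>2 \<partial>N)"
        unfolding VB_def by (rule sum.cong[OF refl], subst uB(2)) simp_all
      show "integrable N (B s2)"
        "(\<integral>z. B s2 z \<partial>N) = real n * ln (\<tau>2 / \<sigma>) + VB s2 / (2 * \<tau>2\<^sup>2) - real n / 2"
        unfolding B_def VB
        by (rule integral_sum_llr[OF prob_space_N sigma_pos tau2(1)]; simp only: uB(1) z2 mom)+
    qed
    have valC: "integrable N (C s2)"
      "(\<integral>z. C s2 z \<partial>N) = real k * ln (\<tau>3 / \<sigma>) + VC s2 / (2 * \<tau>3\<^sup>2) - real k / 2" for s2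
      using integral_sum_llr[OF prob_space_N sigma_pos tau3, of k
          "\<lambda>j z. \<gamma>s * g3 s2 j + snd (snd z) j" "\<lambda>j z. snd (snd z) j"]
      unfolding C_def VC_def by (simp_all add: u3 z3 mom)
    show "integrable N (L s1 s2)" if "s1 < M1" "s2 < M2" for s1 s2
      unfolding L_def using valA[OF that] valB valC by simp
    have "(\<Sum>s1<M1. \<Sum>s2<M2. \<integral>z. A s1 s2 z \<partial>N) \<le> real M1 * real M2 * (real n * ln (\<tau>1 / \<sigma>))"
    proof -
      \<comment> \<open>Twice the product is at most the sum of the squares. This is the only place
        where the dependence between X1 and X2 is paid for.\<close>
      have le: "(\<integral>z. (\<gamma>1 * X s1 s2 i z + \<gamma>m * g2 s2 i)\<^sup>2 \<partial>gaussV \<sigma> n)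
          \<le> 2 * \<gamma>1\<^sup>2 * (\<integral>z. (X s1 s2 i z)\<^sup>2 \<partial>gaussV \<sigma> n) + 2 * \<gamma>m\<^sup>2 * (g2 s2 i)\<^sup>2"
        if "s1 < M1" "s2 < M2" "i < n" for s1 s2 i
      proof -
        interpret prob_space "gaussV \<sigma> n" by (rule prob_space_gaussV[OF sigma_pos])
        have "(\<integral>z. (\<gamma>1 * X s1 s2 i z + \<gamma>m * g2 s2 i)\<^sup>2 \<partial>gaussV \<sigma> n)
          \<le> (\<integral>z. 2 * \<gamma>1\<^sup>2 * (X s1 s2 i z)\<^sup>2 + 2 * \<gamma>m\<^sup>2 * (g2 s2 i)\<^sup>2 \<partial>gaussV \<sigma> n)"
        proof (rule integral_mono)
          show "(\<gamma>1 * X s1 s2 i z + \<gamma>m * g2 s2 i)\<^sup>2 \<le> 2 * \<gamma>1\<^sup>2 * (X s1 s2 i z)\<^sup>2 + 2 * \<gamma>m\<^sup>2 * (g2 s2 i)\<^sup>2" for z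
            using sum_squares_bound[of "\<gamma>1 * X s1 s2 i z" "\<gamma>m * g2 s2 i"]
            by (simp add: power2_sum power_mult_distrib)
        qed (use sqI[OF that] X_power(1)[OF that] in auto)
        then show ?thesis
          using X_power(1)[OF that] by (simp add: prob_space)
      qed
      have "(\<Sum>s1<M1. \<Sum>s2<M2. VA s1 s2)
        \<le> (\<Sum>s1<M1. \<Sum>s2<M2. \<Sum>i<n. (2 * \<gamma>1\<^sup>2 * (\<integral>z. (X s1 s2 i z)\<^sup>2 \<partial>gaussV \<sigma> n) + 2 * \<gamma>m\<^sup>2 * (g2 s2 i)\<^sup>2) + \<sigma>\<^sup>2)"
        unfolding VA_def by (intro sum_mono add_right_mono le) auto
      also have "\<dots> = 2 * \<gamma>1\<^sup>2 * (\<Sum>s1<M1. \<Sum>s2<M2. \<Sum>i<n. \<integral>z. (X s1 s2 i z)\<^sup>2 \<partial>gaussV \<sigma> n)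
          + real M1 * (2 * \<gamma>m\<^sup>2 * (\<Sum>s2<M2. \<Sum>i<n. (g2 s2 i)\<^sup>2)) + real M1 * real M2 * real n * \<sigma>\<^sup>2"
        by (simp add: sum.distrib sum_distrib_left)
      also have "\<dots> \<le> 2 * \<gamma>1\<^sup>2 * (real M1 * real M2 * real n * P1)
          + real M1 * (2 * \<gamma>m\<^sup>2 * (\<Sum>s2<M2. \<Sum>i<n. (g2 s2 i)\<^sup>2)) + real M1 * real M2 * real n * \<sigma>\<^sup>2"
        by (intro add_right_mono mult_left_mono X_power(2)) auto
      also have "\<dots> = card S * (real n * \<tau>1\<^sup>2)"
        unfolding sum_g2 tau1 by (simp add: algebra_simps)
      finally have "(\<Sum>s\<in>S. VA (fst s) (snd s)) \<le> card S * (real n * \<tau>1\<^sup>2)"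
        by (simp only: sum.cartesian_product' fst_conv snd_conv)
      from average_llr_le[OF tau1(1) this] show ?thesis
        by (simp add: valA sum.cartesian_product')
    qed
    moreover have "(\<Sum>s1<M1. \<Sum>s2<M2. \<integral>z. B s2 z \<partial>N) \<le> real M1 * real M2 * (real n * ln (\<tau>2 / \<sigma>))"
    proof -
      \<comment> \<open>Equality holds here: by the least-squares identity the average residual
        power is exactly the variance of the reference.\<close>
      have "(\<Sum>s2<M2. VB s2) = (\<gamma>2 - \<alpha> * \<gamma>m)\<^sup>2 * (\<Sum>s2<M2. \<Sum>i<n. (g2 s2 i)\<^sup>2)
          + real M2 * (real n * (\<sigma>\<^sup>2 + \<alpha>\<^sup>2 * \<sigma>\<^sup>2))"
        by (simp add: VB_def sum.distrib sum_distrib_left power_mult_distrib distrib_left)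
      also have "\<dots> = card {..<M2} * (real n * \<tau>2\<^sup>2)"
        unfolding sum_g2 tau2' by (simp add: algebra_simps)
      finally have "(\<Sum>s2<M2. \<integral>z. B s2 z \<partial>N) \<le> real M2 * (real n * ln (\<tau>2 / \<sigma>))"
        using average_llr_le[OF tau2(1), of VB "{..<M2}" n \<sigma>] by (simp add: valB)
      then have "real M1 * (\<Sum>s2<M2. \<integral>z. B s2 z \<partial>N) \<le> real M1 * (real M2 * (real n * ln (\<tau>2 / \<sigma>)))"
        by (rule mult_left_mono) simp
      then show ?thesis by (simp add: mult_ac)
    qed
    moreover have "(\<Sum>s1<M1. \<Sum>s2<M2. \<integral>z. C s2 z \<partial>N) = real M1 * real M2 *
        (real k * ln (\<tau>3 / \<sigma>) + (real k * \<sigma>\<^sup>2 + real n * \<gamma>s\<^sup>2 * p3) / (2 * \<tau>3\<^sup>2) - real k / 2)"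
    proof -
      have "(\<Sum>s2<M2. VC s2) = \<gamma>s\<^sup>2 * (\<Sum>s2<M2. \<Sum>j<k. (g3 s2 j)\<^sup>2) + real M2 * (real k * \<sigma>\<^sup>2)"
        by (simp add: VC_def sum.distrib sum_distrib_left power_mult_distrib)
      also have "\<dots> = real M2 * (real k * \<sigma>\<^sup>2 + real n * \<gamma>s\<^sup>2 * p3)"
        unfolding sum_g3 by (simp add: algebra_simps)
      finally show ?thesis
        by (simp add: valC sum.distrib sum_subtractf sum_divide_distrib[symmetric]) (simp add: algebra_simps)
    qed
    moreover have "(\<Sum>s1<M1. \<Sum>s2<M2. \<integral>z. L s1 s2 z \<partial>N)
      = (\<Sum>s1<M1. \<Sum>s2<M2. \<integral>z. A s1 s2 z \<partial>N) + (\<Sum>s1<M1. \<Sum>s2<M2. \<integral>z. B s2 z \<partial>N)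
        + (\<Sum>s1<M1. \<Sum>s2<M2. \<integral>z. C s2 z \<partial>N)"
      unfolding sum.distrib[symmetric]
    proof (intro sum.cong refl)
      fix s1 s2 assume "s1 \<in> {..<M1}" "s2 \<in> {..<M2}"
      then show "(\<integral>z. L s1 s2 z \<partial>N) = (\<integral>z. A s1 s2 z \<partial>N) + (\<integral>z. B s2 z \<partial>N) + (\<integral>z. C s2 z \<partial>N)"
        unfolding L_def using valA(1)[of s1 s2] valB(1)[of s2] valC(1)[of s2] by simp
    qed
    ultimately show "(\<Sum>s1<M1. \<Sum>s2<M2. \<integral>z. L s1 s2 z \<partial>N) \<le> real M1 * real M2 * b"
      unfolding b_def distrib_left[of "real M1 * real M2"] by linarith
  qed
  moreover have "real n * ln (\<tau>1 / \<sigma>) = real n / 2 * ln ((\<sigma>\<^sup>2 + 2 * \<gamma>1\<^sup>2 * P1 + 2 * \<gamma>m\<^sup>2 * p2) / \<sigma>\<^sup>2)"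
    unfolding tau1(2)[symmetric] using tau1(1) sigma_pos
    by (simp add: power_divide[symmetric] ln_realpow)
  moreover have "real n * ln (\<tau>2 / \<sigma>) = real n / 2 * ln (1 + \<gamma>2\<^sup>2 * p2 / (\<gamma>m\<^sup>2 * p2 + \<sigma>\<^sup>2))"
  proof -
    have "1 + \<gamma>2\<^sup>2 * p2 / (\<gamma>m\<^sup>2 * p2 + \<sigma>\<^sup>2) = (\<tau>2 / \<sigma>)\<^sup>2"
      unfolding power_divide tau2(2) using sigma_pos by simp
    then show ?thesis
      using tau2(1) sigma_pos by (simp add: ln_realpow)
  qed
  ultimately show ?thesis
    by (simp add: b_def)
qed

end

section \<open>Outer bound and gap\<close>

text \<open>This is ln y <= y - 1 at y = 1 / (1 + u). It pays for side-channel samples that a code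
  with k < W n leaves idle.\<close>

lemma div_add_one_le_ln:
  fixes u :: real
  assumes "u \<ge> 0"
  shows "u / (1 + u) \<le> ln (1 + u)"
proof -
  have "ln (1 / (1 + u)) \<le> 1 / (1 + u) - 1"
    using assms by (intro ln_le_minus_one) auto
  then show ?thesis
    using assms by (simp add: ln_div field_simps)
qed

text \<open>The second summand is what Y2 reveals about \<open>S2\<close> beyond Y1 - \<gamma>1 X1;
  the doubled argument of the first comes from the correlation of X1 with X2.\<close>

definition sum_rate_outer :: "real \<Rightarrow> real \<Rightarrow> real \<Rightarrow> real \<Rightarrow> real \<Rightarrow> real \<Rightarrow> real \<Rightarrow> real" where
  "sum_rate_outer Wm W snr1 snr2 inr snrs lam =
     Cap Wm (2 * snr1 + 2 * ((1 - lam) * inr))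
     + Cap Wm ((1 - lam) * snr2 / (1 + (1 - lam) * inr)) + WCap Wm W (lam * snrs)"

context full_duplex_code
begin

text \<open>For W = 0 there are no side-channel samples, hence no power on them, and every
  \<open>\<tau>\<close> gives 0. Otherwise the variance is the one that would be optimal if the
  energy were spread over all W n available samples.\<close>

lemma side_channel_term_le:
  assumes W: "0 \<le> W" "real k \<le> W * real n" and x: "\<gamma>s\<^sup>2 * p3 / \<sigma>\<^sup>2 \<le> x"
  shows "\<exists>\<tau>>0. real k * ln (\<tau> / \<sigma>) + (real k * \<sigma>\<^sup>2 + real n * \<gamma>s\<^sup>2 * p3) / (2 * \<tau>\<^sup>2) - real k / 2
    \<le> real n / 2 * (W * ln (1 + x / W))"
proof (cases "W = 0")
  case True
  then have "k = 0" using W by simp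
  then have "p3 = 0" unfolding p3_def by simp
  with True \<open>k = 0\<close> sigma_pos show ?thesis by auto
next
  case False
  define u where "u = x / W"
  have x0: "x \<ge> 0"
    by (rule order_trans[OF _ x]) (use p3_nonneg in auto)
  have u: "u \<ge> 0" "x = W * u" using W False x0 by (auto simp: u_def)
  define \<tau> where "\<tau> = \<sigma> * sqrt (1 + u)"
  have tau: "\<tau> > 0" "\<tau>\<^sup>2 = \<sigma>\<^sup>2 * (1 + u)" "ln (\<tau> / \<sigma>) = ln (1 + u) / 2"
    using sigma_pos u by (auto simp: \<tau>_def power_mult_distrib ln_sqrt)
  have "\<gamma>s\<^sup>2 * p3 \<le> \<sigma>\<^sup>2 * x"
    using x sigma_pos by (simp add: field_simps)
  then have "real n * (\<gamma>s\<^sup>2 * p3) \<le> real n * (\<sigma>\<^sup>2 * x)"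
    by (intro mult_left_mono) auto
  then have "real k * \<sigma>\<^sup>2 + real n * \<gamma>s\<^sup>2 * p3 \<le> \<sigma>\<^sup>2 * (real k + real n * x)"
    by (simp add: algebra_simps)
  then have "(real k * \<sigma>\<^sup>2 + real n * \<gamma>s\<^sup>2 * p3) / (2 * \<tau>\<^sup>2) \<le> \<sigma>\<^sup>2 * (real k + real n * x) / (2 * \<tau>\<^sup>2)"
    by (intro divide_right_mono) auto
  also have "\<dots> = (real k + real n * x) / (2 * (1 + u))"
    unfolding tau using sigma_pos by simp
  \<comment> \<open>What exceeds the rate of the \<open>k\<close> used samples is proportional to
    the number W n - k of idle ones, and the logarithm of 1 + \<open>u\<close> per idle sample
    covers it.\<close>
  also have "\<dots> - real k / 2 = (W * real n - real k) / 2 * (u / (1 + u))"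
    using u by (simp add: field_simps)
  also have "\<dots> \<le> (W * real n - real k) / 2 * ln (1 + u)"
    using W u by (intro mult_left_mono div_add_one_le_ln) auto
  also have "\<dots> = real n / 2 * (W * ln (1 + u)) - real k * (ln (1 + u) / 2)"
    by (simp add: field_simps)
  finally have "real k * ln (\<tau> / \<sigma>) + (real k * \<sigma>\<^sup>2 + real n * \<gamma>s\<^sup>2 * p3) / (2 * \<tau>\<^sup>2) - real k / 2
      \<le> real n / 2 * (W * ln (1 + u))"
    unfolding tau(3) by linarith
  with tau(1) show ?thesis unfolding u_def by blast
qed

lemma code_outer_bound:
  assumes W: "0 \<le> W" "real k \<le> W * real n" and P2: "P2 \<ge> 0"
  obtains lam where "0 \<le> lam" "lam \<le> 1"
    "(1 - \<epsilon>) * ln M1 \<le> real n / 2 * ln (1 + \<gamma>1\<^sup>2 * P1 / \<sigma>\<^sup>2) + ln 2"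
    "(1 - \<epsilon>) * ln M2 \<le> real n / 2 * ln (1 + (1 - lam) * (\<gamma>2\<^sup>2 * P2 / \<sigma>\<^sup>2)) + ln 2"
    "(1 - \<epsilon>) * ln (real M1 * real M2) \<le> real n / 2 *
       (ln (1 + (2 * (\<gamma>1\<^sup>2 * P1 / \<sigma>\<^sup>2) + 2 * ((1 - lam) * (\<gamma>m\<^sup>2 * P2 / \<sigma>\<^sup>2))))
        + ln (1 + (1 - lam) * (\<gamma>2\<^sup>2 * P2 / \<sigma>\<^sup>2) / (1 + (1 - lam) * (\<gamma>m\<^sup>2 * P2 / \<sigma>\<^sup>2)))
        + W * ln (1 + lam * (\<gamma>s\<^sup>2 * P2 / \<sigma>\<^sup>2) / W)) + ln 2"
proof -
  \<comment> \<open>The share on the main channel is matched exactly by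
    \<open>lam = 1 - p2 / P2\<close>; unspent power is credited to the side channel, where the bound
    increases with power. For \<open>P2 = 0\<close> any split does.\<close>
  obtain lam where lam: "0 \<le> lam" "lam \<le> 1" and p2: "p2 = (1 - lam) * P2" and p3: "p3 \<le> lam * P2"
  proof (cases "P2 = 0")
    case True
    then show ?thesis using that[of 0] p2_nonneg p3_nonneg power_split by simp
  next
    case False
    then have "P2 > 0" using P2 by simp
    then show ?thesis
      using p2_nonneg p3_nonneg power_split
      by (intro that[of "1 - p2 / P2"]) (auto simp: left_diff_distrib)
  qed
  have s: "\<sigma>\<^sup>2 > 0" using sigma_pos by simp
  have a: "(1 - lam) * (\<gamma>m\<^sup>2 * P2 / \<sigma>\<^sup>2) = \<gamma>m\<^sup>2 * p2 / \<sigma>\<^sup>2" "(1 - lam) * (\<gamma>2\<^sup>2 * P2 / \<sigma>\<^sup>2) = \<gamma>2\<^sup>2 * p2 / \<sigma>\<^sup>2"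
    by (simp_all add: p2)
  have "\<gamma>s\<^sup>2 * p3 / \<sigma>\<^sup>2 \<le> \<gamma>s\<^sup>2 * (lam * P2) / \<sigma>\<^sup>2"
    using p3 by (intro divide_right_mono mult_left_mono) auto
  then have "\<gamma>s\<^sup>2 * p3 / \<sigma>\<^sup>2 \<le> lam * (\<gamma>s\<^sup>2 * P2 / \<sigma>\<^sup>2)"
    by (simp add: mult_ac)
  from side_channel_term_le[OF W this] obtain \<tau> where tau: "\<tau> > 0"
    and side: "real k * ln (\<tau> / \<sigma>) + (real k * \<sigma>\<^sup>2 + real n * \<gamma>s\<^sup>2 * p3) / (2 * \<tau>\<^sup>2) - real k / 2
      \<le> real n / 2 * (W * ln (1 + lam * (\<gamma>s\<^sup>2 * P2 / \<sigma>\<^sup>2) / W))"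
    by blast
  have e1: "(\<sigma>\<^sup>2 + \<gamma>1\<^sup>2 * P1) / \<sigma>\<^sup>2 = 1 + \<gamma>1\<^sup>2 * P1 / \<sigma>\<^sup>2"
    and e2: "(\<sigma>\<^sup>2 + \<gamma>2\<^sup>2 * p2) / \<sigma>\<^sup>2 = 1 + \<gamma>2\<^sup>2 * p2 / \<sigma>\<^sup>2"
    and e3: "(\<sigma>\<^sup>2 + 2 * \<gamma>1\<^sup>2 * P1 + 2 * \<gamma>m\<^sup>2 * p2) / \<sigma>\<^sup>2 = 1 + (2 * (\<gamma>1\<^sup>2 * P1 / \<sigma>\<^sup>2) + 2 * (\<gamma>m\<^sup>2 * p2 / \<sigma>\<^sup>2))"
    using s by (simp_all add: field_simps)
  have e4: "\<gamma>2\<^sup>2 * p2 / (\<gamma>m\<^sup>2 * p2 + \<sigma>\<^sup>2) = \<gamma>2\<^sup>2 * p2 / \<sigma>\<^sup>2 / (1 + \<gamma>m\<^sup>2 * p2 / \<sigma>\<^sup>2)"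
  proof -
    have "\<gamma>m\<^sup>2 * p2 + \<sigma>\<^sup>2 > 0" using s p2_nonneg by (intro add_nonneg_pos) auto
    moreover have "1 + \<gamma>m\<^sup>2 * p2 / \<sigma>\<^sup>2 = (\<gamma>m\<^sup>2 * p2 + \<sigma>\<^sup>2) / \<sigma>\<^sup>2" using s by (simp add: field_simps)
    ultimately show ?thesis using s by simp
  qed
  show ?thesis
  proof (rule that[OF lam])
    show "(1 - \<epsilon>) * ln M1 \<le> real n / 2 * ln (1 + \<gamma>1\<^sup>2 * P1 / \<sigma>\<^sup>2) + ln 2"
      using rate1_bound unfolding e1 .
    show "(1 - \<epsilon>) * ln M2 \<le> real n / 2 * ln (1 + (1 - lam) * (\<gamma>2\<^sup>2 * P2 / \<sigma>\<^sup>2)) + ln 2"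
      using rate2_bound unfolding e2 a .
    show "(1 - \<epsilon>) * ln (real M1 * real M2) \<le> real n / 2 *
       (ln (1 + (2 * (\<gamma>1\<^sup>2 * P1 / \<sigma>\<^sup>2) + 2 * ((1 - lam) * (\<gamma>m\<^sup>2 * P2 / \<sigma>\<^sup>2))))
        + ln (1 + (1 - lam) * (\<gamma>2\<^sup>2 * P2 / \<sigma>\<^sup>2) / (1 + (1 - lam) * (\<gamma>m\<^sup>2 * P2 / \<sigma>\<^sup>2)))
        + W * ln (1 + lam * (\<gamma>s\<^sup>2 * P2 / \<sigma>\<^sup>2) / W)) + ln 2"
      using sum_rate_bound[OF tau] side unfolding e3 e4 a distrib_left[of "real n / 2"] by linarith
  qed
qed

end

section \<open>From a single code to the capacity region\<close>

text \<open>Half of \<open>\<delta>\<close> absorbs the ln 2, through a large block length; the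
  other half absorbs the error probability and the rate slack. The factor \<open>j\<close> counts
  the slacks: 1 for an individual rate, 2 for the sum.\<close>

lemma rate_from_code_bound:
  fixes r A R \<epsilon> \<delta> Wm :: real
  assumes Wm: "Wm > 0" and n: "n > 0" "4 * Wm \<le> \<delta> * real n" and e: "0 < \<epsilon>" "\<epsilon> \<le> 1" "\<epsilon> * (j + R) \<le> \<delta> / 2" "j \<ge> 0"
    and r: "real n * (R - j * \<epsilon>) \<le> 2 * Wm * (l / ln 2)" and l: "(1 - \<epsilon>) * l \<le> real n / 2 * A + ln 2"
  shows "R \<le> Wm * (A / ln 2) + \<delta>"
proof -
  have "(1 - \<epsilon>) * (real n * (R - j * \<epsilon>)) \<le> (1 - \<epsilon>) * (2 * Wm * (l / ln 2))"
    using e r by (intro mult_left_mono) auto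
  also have "\<dots> = 2 * Wm / ln 2 * ((1 - \<epsilon>) * l)"
    by simp
  also have "\<dots> \<le> 2 * Wm / ln 2 * (real n / 2 * A + ln 2)"
    using Wm l by (intro mult_left_mono) auto
  also have "\<dots> = real n * (Wm * (A / ln 2)) + 2 * Wm"
    by (simp add: field_simps)
  also have "\<dots> \<le> real n * (Wm * (A / ln 2)) + real n * (\<delta> / 2)"
    using n by (simp add: field_simps)
  finally have "real n * ((1 - \<epsilon>) * (R - j * \<epsilon>)) \<le> real n * (Wm * (A / ln 2) + \<delta> / 2)"
    by (simp add: algebra_simps)
  then have "(1 - \<epsilon>) * (R - j * \<epsilon>) \<le> Wm * (A / ln 2) + \<delta> / 2"
    using n by (simp add: mult_le_cancel_left)
  moreover have "(1 - \<epsilon>) * (R - j * \<epsilon>) = R - \<epsilon> * (j + R) + j * \<epsilon>\<^sup>2"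
    by (simp add: power2_eq_square algebra_simps)
  moreover have "j * \<epsilon>\<^sup>2 \<ge> 0"
    using e by simp
  ultimately show ?thesis
    using e by linarith
qed

lemma Cap_eq_ln: "Cap Wm x = Wm * (ln (1 + x) / ln 2)"
  by (simp add: Cap_def log_def)

text \<open>The leading factor \<open>W\<close> makes the formula vanish at \<open>W = 0\<close>, so
  the limit argument needs no case distinction.\<close>

lemma WCap_eq_ln: "WCap Wm W x = Wm * (W * ln (1 + x / W) / ln 2)"
  by (simp add: WCap_def Cap_eq_ln)

lemma achievable_outer_bound:
  assumes "\<sigma> > 0" "P1 \<ge> 0" "P2 \<ge> 0" "Wm > 0" "0 \<le> W" "\<delta> > 0"
    and ach: "achievable \<gamma>1 \<gamma>m \<gamma>s \<gamma>2 \<sigma> P1 P2 Wm W R1 R2"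
  shows "\<exists>lam\<in>{0..1}. R1 \<le> Cap Wm (\<gamma>1\<^sup>2 * P1 / \<sigma>\<^sup>2) + \<delta>
    \<and> R2 \<le> Cap Wm ((1 - lam) * (\<gamma>2\<^sup>2 * P2 / \<sigma>\<^sup>2)) + \<delta>
    \<and> R1 + R2 \<le> sum_rate_outer Wm W (\<gamma>1\<^sup>2 * P1 / \<sigma>\<^sup>2) (\<gamma>2\<^sup>2 * P2 / \<sigma>\<^sup>2) (\<gamma>m\<^sup>2 * P2 / \<sigma>\<^sup>2)
        (\<gamma>s\<^sup>2 * P2 / \<sigma>\<^sup>2) lam + \<delta>"
proof -
  have R: "R1 \<ge> 0" "R2 \<ge> 0" using ach by (auto simp: achievable_def)
  \<comment> \<open>Small enough for all three bounds at once: the sum rate has the largest loss,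
    \<open>\<epsilon>\<close> times 2 + R1 + R2.\<close>
  define \<epsilon> where "\<epsilon> = min 1 (\<delta> / (2 * (2 + R1 + R2)))"
  have e: "0 < \<epsilon>" "\<epsilon> \<le> 1"
    using R assms by (auto simp: \<epsilon>_def)
  have "\<epsilon> * (2 + R1 + R2) \<le> \<delta> / (2 * (2 + R1 + R2)) * (2 + R1 + R2)"
    using R by (intro mult_right_mono) (auto simp: \<epsilon>_def)
  also have "\<dots> = \<delta> / 2"
    using R by (simp add: field_simps)
  finally have e3: "\<epsilon> * (2 + (R1 + R2)) \<le> \<delta> / 2" by (simp add: add.assoc)
  have e1: "\<epsilon> * (1 + R1) \<le> \<delta> / 2" and e2: "\<epsilon> * (1 + R2) \<le> \<delta> / 2"
    using e3 mult_left_mono[of "1 + R1" "2 + (R1 + R2)" \<epsilon>] mult_left_mono[of "1 + R2" "2 + (R1 + R2)" \<epsilon>] e R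
    by linarith+
  define N where "N = nat \<lceil>4 * Wm / \<delta>\<rceil> + 1"
  obtain n k M1 M2 f1 g2 g3 d2 d1 where n: "n \<ge> N" and k: "real k \<le> W * real n"
    and r1: "2 * Wm * log 2 (real M1) \<ge> real n * (R1 - \<epsilon>)"
    and r2: "2 * Wm * log 2 (real M2) \<ge> real n * (R2 - \<epsilon>)"
    and code: "code_ok \<gamma>1 \<gamma>m \<gamma>s \<gamma>2 \<sigma> P1 P2 n k M1 M2 f1 g2 g3 d2 d1 \<epsilon>"
    using ach e(1) unfolding achievable_def by blast
  have n0: "n > 0" using n by (simp add: N_def)
  have "4 * Wm / \<delta> \<le> real n"
    using n unfolding N_def by linarith
  then have nd: "4 * Wm \<le> \<delta> * real n"
    using assms by (simp add: field_simps)
  interpret full_duplex_code \<gamma>1 \<gamma>m \<gamma>s \<gamma>2 \<sigma> P1 P2 n k M1 M2 f1 g2 g3 d2 d1 \<epsilon>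
    using assms n0 code by unfold_locales
  obtain lam where lam: "0 \<le> lam" "lam \<le> 1"
    and b: "(1 - \<epsilon>) * ln M1 \<le> real n / 2 * ln (1 + \<gamma>1\<^sup>2 * P1 / \<sigma>\<^sup>2) + ln 2"
    "(1 - \<epsilon>) * ln M2 \<le> real n / 2 * ln (1 + (1 - lam) * (\<gamma>2\<^sup>2 * P2 / \<sigma>\<^sup>2)) + ln 2"
    "(1 - \<epsilon>) * ln (real M1 * real M2) \<le> real n / 2 *
       (ln (1 + (2 * (\<gamma>1\<^sup>2 * P1 / \<sigma>\<^sup>2) + 2 * ((1 - lam) * (\<gamma>m\<^sup>2 * P2 / \<sigma>\<^sup>2))))
        + ln (1 + (1 - lam) * (\<gamma>2\<^sup>2 * P2 / \<sigma>\<^sup>2) / (1 + (1 - lam) * (\<gamma>m\<^sup>2 * P2 / \<sigma>\<^sup>2)))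
        + W * ln (1 + lam * (\<gamma>s\<^sup>2 * P2 / \<sigma>\<^sup>2) / W)) + ln 2"
    using code_outer_bound[OF assms(5) k assms(3)] by blast
  have r3: "real n * (R1 + R2 - 2 * \<epsilon>) \<le> 2 * Wm * (ln (real M1 * real M2) / ln 2)"
    using r1 r2 M1_pos M2_pos by (simp add: log_def ln_mult add_divide_distrib algebra_simps)
  have "R1 \<le> Cap Wm (\<gamma>1\<^sup>2 * P1 / \<sigma>\<^sup>2) + \<delta>"
    unfolding Cap_eq_ln using rate_from_code_bound[OF assms(4) n0 nd e e1 _ _ b(1)] r1 by (simp add: log_def)
  moreover have "R2 \<le> Cap Wm ((1 - lam) * (\<gamma>2\<^sup>2 * P2 / \<sigma>\<^sup>2)) + \<delta>"
    unfolding Cap_eq_ln using rate_from_code_bound[OF assms(4) n0 nd e e2 _ _ b(2)] r2 by (simp add: log_def)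
  moreover have "R1 + R2 \<le> sum_rate_outer Wm W (\<gamma>1\<^sup>2 * P1 / \<sigma>\<^sup>2) (\<gamma>2\<^sup>2 * P2 / \<sigma>\<^sup>2) (\<gamma>m\<^sup>2 * P2 / \<sigma>\<^sup>2)
        (\<gamma>s\<^sup>2 * P2 / \<sigma>\<^sup>2) lam + \<delta>"
    unfolding sum_rate_outer_def Cap_eq_ln WCap_eq_ln distrib_left[of Wm, symmetric] add_divide_distrib[symmetric]
    by (rule rate_from_code_bound[OF assms(4) n0 nd e e3 _ r3 b(3)]) simp
  ultimately show ?thesis
    using lam by auto
qed

text \<open>So far the power split varies with the tolerance. One split for all tolerances is found
  by minimising the larger violation over the compact interval; the minimum is below every positive
  tolerance, hence not positive.\<close>

lemma capacity_region_outer_bound: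
  assumes "\<sigma> > 0" "P1 \<ge> 0" "P2 \<ge> 0" "Wm > 0" "0 \<le> W"
    and cap: "(R1, R2) \<in> capacity_region \<gamma>1 \<gamma>m \<gamma>s \<gamma>2 \<sigma> P1 P2 Wm W"
  obtains lam where "0 \<le> lam" "lam \<le> 1" "R1 \<le> Cap Wm (\<gamma>1\<^sup>2 * P1 / \<sigma>\<^sup>2)"
    "R2 \<le> Cap Wm ((1 - lam) * (\<gamma>2\<^sup>2 * P2 / \<sigma>\<^sup>2))"
    "R1 + R2 \<le> sum_rate_outer Wm W (\<gamma>1\<^sup>2 * P1 / \<sigma>\<^sup>2) (\<gamma>2\<^sup>2 * P2 / \<sigma>\<^sup>2) (\<gamma>m\<^sup>2 * P2 / \<sigma>\<^sup>2)
        (\<gamma>s\<^sup>2 * P2 / \<sigma>\<^sup>2) lam"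
proof -
  define snr2 where "snr2 = \<gamma>2\<^sup>2 * P2 / \<sigma>\<^sup>2"
  define inr where "inr = \<gamma>m\<^sup>2 * P2 / \<sigma>\<^sup>2"
  define snrs where "snrs = \<gamma>s\<^sup>2 * P2 / \<sigma>\<^sup>2"
  define snr1 where "snr1 = \<gamma>1\<^sup>2 * P1 / \<sigma>\<^sup>2"
  have nonneg: "snr1 \<ge> 0" "snr2 \<ge> 0" "inr \<ge> 0" "snrs \<ge> 0"
    using assms by (auto simp: snr1_def snr2_def inr_def snrs_def)
  let ?U1 = "Cap Wm snr1" and ?U2 = "\<lambda>lam. Cap Wm ((1 - lam) * snr2)"
    and ?U3 = "sum_rate_outer Wm W snr1 snr2 inr snrs"
  have approx: "\<exists>lam\<in>{0..1}. R1 \<le> ?U1 + \<delta> \<and> R2 \<le> ?U2 lam + \<delta> \<and> R1 + R2 \<le> ?U3 lam + \<delta>"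
    if "\<delta> > 0" for \<delta>
  proof -
    \<comment> \<open>Passing to the closure costs a quarter per coordinate, so even the sum loses
      only half; the other half is the tolerance for the achievable pair.\<close>
    have "\<delta> / 4 > 0" and half: "\<delta> / 2 > 0" using that by simp_all
    obtain p where p: "p \<in> {(R1, R2). achievable \<gamma>1 \<gamma>m \<gamma>s \<gamma>2 \<sigma> P1 P2 Wm W R1 R2}"
      and d: "dist p (R1, R2) < \<delta> / 4"
      using cap \<open>\<delta> / 4 > 0\<close> unfolding capacity_region_def closure_approachable by blast
    obtain Q1 Q2 where pq: "p = (Q1, Q2)" by (cases p)
    have "dist Q1 R1 < \<delta> / 4" "dist Q2 R2 < \<delta> / 4"
      using d dist_fst_le[of p "(R1, R2)"] dist_snd_le[of p "(R1, R2)"] by (simp_all add: pq)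
    then have R: "R1 < Q1 + \<delta> / 4" "R2 < Q2 + \<delta> / 4"
      unfolding dist_real_def by linarith+
    have ach: "achievable \<gamma>1 \<gamma>m \<gamma>s \<gamma>2 \<sigma> P1 P2 Wm W Q1 Q2"
      using p by (simp add: pq)
    obtain lam where *: "lam \<in> {0..1}" "Q1 \<le> ?U1 + \<delta> / 2" "Q2 \<le> ?U2 lam + \<delta> / 2" "Q1 + Q2 \<le> ?U3 lam + \<delta> / 2"
      using achievable_outer_bound[OF assms(1-5) half ach]
      unfolding snr1_def snr2_def inr_def snrs_def by blast
    show ?thesis
    proof (intro bexI[of _ lam] conjI)
      show "R1 \<le> ?U1 + \<delta>" "R2 \<le> ?U2 lam + \<delta>" "R1 + R2 \<le> ?U3 lam + \<delta>"
        using R * that by linarith+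
    qed (rule *(1))
  qed
  have R1: "R1 \<le> ?U1"
  proof (rule field_le_epsilon)
    show "R1 \<le> ?U1 + \<delta>" if "\<delta> > 0" for \<delta>
      using approx[OF that] by blast
  qed
  \<comment> \<open>The bound on \<open>R1\<close> does not involve the split, so only the other two
    constraints enter.\<close>
  let ?g = "\<lambda>lam. max (R2 - ?U2 lam) (R1 + R2 - ?U3 lam)"
  have "continuous_on {0..1} ?g"
  proof -
    have pos: "1 + (1 - lam) * x > 0" "1 + lam * x > 0" if "lam \<in> {0..1}" "x \<ge> 0" for lam x :: real
      using that by (auto intro!: add_pos_nonneg)
    have c2: "continuous_on {0..1} ?U2"
      unfolding Cap_eq_ln using pos(1)[OF _ nonneg(2)]
      by (intro continuous_intros) force+
    have "1 + (2 * snr1 + 2 * ((1 - lam) * inr)) > 0" if "lam \<in> {0..1}" for lam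
      using that nonneg by (intro add_pos_nonneg) auto
    then have "continuous_on {0..1} (\<lambda>lam. Cap Wm (2 * snr1 + 2 * ((1 - lam) * inr)))"
      unfolding Cap_eq_ln by (intro continuous_intros) force+
    moreover have "1 + (1 - lam) * snr2 / (1 + (1 - lam) * inr) > 0" if "lam \<in> {0..1}" for lam
      using that nonneg by (intro add_pos_nonneg divide_nonneg_nonneg) auto
    then have "continuous_on {0..1} (\<lambda>lam. Cap Wm ((1 - lam) * snr2 / (1 + (1 - lam) * inr)))"
      unfolding Cap_eq_ln using pos(1)[OF _ nonneg(3)] by (intro continuous_intros) force+
    moreover have "1 + lam * snrs / W > 0" if "lam \<in> {0..1}" for lam
      using that nonneg assms by (intro add_pos_nonneg) auto
    then have "continuous_on {0..1} (\<lambda>lam. WCap Wm W (lam * snrs))"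
      unfolding WCap_eq_ln divide_inverse by (intro continuous_intros) force+
    ultimately have "continuous_on {0..1} ?U3"
      unfolding sum_rate_outer_def by (intro continuous_intros)
    with c2 show ?thesis by (intro continuous_intros)
  qed
  then obtain lam where lam: "lam \<in> {0..1}" and min: "\<And>l. l \<in> {0..1} \<Longrightarrow> ?g lam \<le> ?g l"
    using continuous_attains_inf[of "{0..1::real}" ?g] by auto
  have "?g lam \<le> 0 + \<delta>" if "\<delta> > 0" for \<delta>
  proof -
    note near = approx[OF that]
    obtain l where l: "l \<in> {0..1}" "R2 \<le> ?U2 l + \<delta>" "R1 + R2 \<le> ?U3 l + \<delta>"
      using near by blast
    then have "?g l \<le> 0 + \<delta>" by auto
    with min[OF l(1)] show ?thesis by (rule order_trans)
  qed
  then have "?g lam \<le> 0"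
    by (rule field_le_epsilon)
  with lam R1 show ?thesis
    by (intro that[of lam]) (auto simp: snr1_def snr2_def inr_def snrs_def)
qed

section \<open>Comparison with the bin-and-cancel region\<close>

lemma Cap_mono: "Wm > 0 \<Longrightarrow> 0 \<le> x \<Longrightarrow> x \<le> y \<Longrightarrow> Cap Wm x \<le> Cap Wm y"
  by (simp add: Cap_def)

text \<open>A factor of two inside the logarithm is one bit per Hz of the main channel; every loss
  below is reduced to this.\<close>

lemma Cap_le_plus:
  assumes "Wm > 0" "x \<ge> 0" "y \<ge> 0" "1 + x \<le> 2 * (1 + y)"
  shows "Cap Wm x \<le> Cap Wm y + Wm"
proof -
  have "log 2 (1 + x) \<le> log 2 (2 * (1 + y))"
    using assms by simp
  also have "\<dots> = 1 + log 2 (1 + y)"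
    using assms by (subst log_mult) auto
  finally have "Wm * log 2 (1 + x) \<le> Wm * (1 + log 2 (1 + y))"
    using assms by (intro mult_left_mono) auto
  then show ?thesis by (simp add: Cap_def algebra_simps)
qed

lemma Cap_add:
  assumes "y \<ge> 0" "z \<ge> 0"
  shows "Cap Wm y + Cap Wm z = Cap Wm ((1 + y) * (1 + z) - 1)"
proof -
  have "log 2 ((1 + y) * (1 + z)) = log 2 (1 + y) + log 2 (1 + z)"
    using assms by (subst log_mult) auto
  then show ?thesis by (simp add: Cap_def algebra_simps)
qed

lemma Cap_0 [simp]: "Cap Wm 0 = 0"
  by (simp add: Cap_def)

lemma WCap_nonneg: "Wm > 0 \<Longrightarrow> W \<ge> 0 \<Longrightarrow> x \<ge> 0 \<Longrightarrow> WCap Wm W x \<ge> 0"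
  using Cap_mono[of Wm 0 "x / W"] by (simp add: WCap_def)

text \<open>With \<open>bet\<close> chosen so that the undecoded part of the interference is at most
  the noise, 1 + bet (1 - lam) INR is at most 2, which costs each user at most one bit.\<close>

lemma weak_interference_gap:
  assumes "Wm > 0" "W \<ge> 0" "snr1 \<ge> 0" "inr \<ge> 0" "snrs \<ge> 0" "inr \<le> snr2" "0 \<le> lam" "lam \<le> 1"
    and R: "R1 \<le> Cap Wm snr1" "R2 \<le> Cap Wm ((1 - lam) * snr2)"
      "R1 + R2 \<le> sum_rate_outer Wm W snr1 snr2 inr snrs lam"
    and g: "g \<ge> Wm"
  shows "(R1 - g, R2 - g) \<in> R_BC Wm W snr1 snr2 inr snrs"
proof -
  define a where "a = (1 - lam) * inr"
  define s where "s = (1 - lam) * snr2"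
  have as: "0 \<le> a" "a \<le> s"
    using assms by (auto simp: a_def s_def intro!: mult_left_mono)
  have side: "WCap Wm W (lam * snrs) \<ge> 0"
    using assms by (intro WCap_nonneg) auto
  have mem: "(R1 - g, R2 - g) \<in> R_BC Wm W snr1 snr2 inr snrs"
    if "bet \<in> {0..1}" "R1 - g \<le> Cap Wm (snr1 / (1 + bet * a))" "R2 - g \<le> Cap Wm s"
      "R2 - g \<le> Cap Wm (bet * s) + Cap Wm ((1 - bet) * a / (1 + bet * a)) + WCap Wm W (lam * snrs)"
      "(R1 - g) + (R2 - g) \<le> Cap Wm (bet * s) + Cap Wm ((snr1 + (1 - bet) * a) / (1 + bet * a)) + WCap Wm W (lam * snrs)"
    for bet
    using that assms(6-8) unfolding R_BC_def a_def s_def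
    by (simp add: mult.assoc) (rule bexI[of _ bet], rule bexI[of _ lam], simp_all)
  show ?thesis
  proof (cases "a \<le> 1")
    case True
    have "Cap Wm snr1 \<le> Cap Wm (snr1 / (1 + a)) + Wm"
    proof (rule Cap_le_plus)
      have "snr1 / 2 \<le> snr1 / (1 + a)"
        using True as assms by (intro divide_left_mono) auto
      from mult_left_mono[OF this, of 2] show "1 + snr1 \<le> 2 * (1 + snr1 / (1 + a))"
        by (simp add: distrib_left)
    qed (use assms as in auto)
    \<comment> \<open>With \<open>bet = 1\<close> all interference is treated as noise. The sum
      constraint then follows by adding the two individual bounds, without the outer bound on the
      sum.\<close>
    then show ?thesis
      using R g side assms by (intro mem[of 1]) (auto simp: s_def)
  next
    case False
    \<comment> \<open>Here \<open>bet = 1 / a\<close> puts the residual interference exactly at the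
      noise level, so the denominators of the region all become 2.\<close>
    have b: "1 / a * a = 1" "1 / a * s = s / a" "(1 - 1 / a) * a = a - 1" "1 / a \<in> {0..1}"
      using False by (auto simp: field_simps)
    have c1: "Cap Wm snr1 \<le> Cap Wm (snr1 / 2) + Wm"
      using assms by (intro Cap_le_plus) auto
    have c2: "Cap Wm s \<le> Cap Wm (s / a) + Cap Wm ((a - 1) / 2) + Wm"
    proof -
      \<comment> \<open>By the addition rule \<open>p\<close> is the argument, with the 1 included,
        of the combined logarithm. Expanding gives 2 p = 1 + a + s / a + s, so one bit covers 1 +
        s.\<close>
      define p where "p = (1 + s / a) * (1 + (a - 1) / 2)"
      define e where "e = s / a"
      have "e * a = s" using False by (simp add: e_def)
      then have p: "2 * p = 1 + a + e + s"
        by (simp add: p_def e_def[symmetric] field_simps)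
      have e0: "e \<ge> 0" using as by (simp add: e_def)
      have "1 + s \<le> 2 * p"
        unfolding p using e0 as by simp
      moreover have "1 \<le> p"
        using p e0 as False by simp
      ultimately have "Cap Wm s \<le> Cap Wm (p - 1) + Wm"
        using assms as by (intro Cap_le_plus) auto
      then show ?thesis using as False by (simp add: Cap_add p_def)
    qed
    \<comment> \<open>Both bits of the sum are spent: the first undoes the doubling caused by
      feedback, the second the halving by the residual interference. The latter comparison is an
      equality of arguments.\<close>
    have c3: "Cap Wm (2 * snr1 + 2 * a) \<le> Cap Wm ((snr1 + (a - 1)) / 2) + Wm + Wm"
    proof -
      have "Cap Wm (2 * snr1 + 2 * a) \<le> Cap Wm (snr1 + a) + Wm"
        using assms as by (intro Cap_le_plus) auto
      also have "Cap Wm (snr1 + a) \<le> Cap Wm ((snr1 + (a - 1)) / 2) + Wm"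
        using assms as False by (intro Cap_le_plus) (auto simp: field_simps)
      finally show ?thesis by simp
    qed
    \<comment> \<open>So the Y2 term of the outer bound is dominated by the rate of the part of the
      uplink message that M2 leaves undecoded.\<close>
    have "s / (1 + a) \<le> s / a"
      using as False by (intro divide_left_mono) auto
    then have c4: "Cap Wm (s / (1 + a)) \<le> Cap Wm (s / a)"
      using assms as by (intro Cap_mono) auto
    have "R1 + R2 \<le> Cap Wm (2 * snr1 + 2 * a) + Cap Wm (s / (1 + a)) + WCap Wm W (lam * snrs)"
      using R(3) by (simp add: sum_rate_outer_def a_def s_def)
    moreover have "R2 \<le> Cap Wm s" using R(2) by (simp add: s_def)
    ultimately show ?thesis
      using R(1) g side assms(1) c1 c2 c3 c4 
      by (intro mem[OF b(4)]) (simp_all add: b(1-3) del: times_divide_eq_left)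
  qed
qed

theorem theorem2:
  fixes \<gamma>1 \<gamma>m \<gamma>s \<gamma>2 \<sigma> P1 P2 Wm W Wmax R1 R2 :: real
  assumes "\<sigma> > 0" and "P1 \<ge> 0" and "P2 \<ge> 0" and "Wm > 0"
    and "0 \<le> W" and "W \<le> Wmax"
    and "(R1, R2) \<in> capacity_region \<gamma>1 \<gamma>m \<gamma>s \<gamma>2 \<sigma> P1 P2 Wm W"
  shows "(R1 - (Wm + W * Wm), R2 - (Wm + W * Wm)) \<in>
           R_BC Wm W (\<gamma>1\<^sup>2 * P1 / \<sigma>\<^sup>2) (\<gamma>2\<^sup>2 * P2 / \<sigma>\<^sup>2)
                (\<gamma>m\<^sup>2 * P2 / \<sigma>\<^sup>2) (\<gamma>s\<^sup>2 * P2 / \<sigma>\<^sup>2)"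
proof -
  let ?snr1 = "\<gamma>1\<^sup>2 * P1 / \<sigma>\<^sup>2" and ?snr2 = "\<gamma>2\<^sup>2 * P2 / \<sigma>\<^sup>2"
    and ?inr = "\<gamma>m\<^sup>2 * P2 / \<sigma>\<^sup>2" and ?snrs = "\<gamma>s\<^sup>2 * P2 / \<sigma>\<^sup>2"
  let ?g = "Wm + W * Wm"
  have nonneg: "?snr1 \<ge> 0" "?snr2 \<ge> 0" "?inr \<ge> 0" "?snrs \<ge> 0"
    using assms by auto
  \<comment> \<open>One bit per Hz of the total bandwidth is at least one bit per Hz of the main
    channel, and the latter is what the comparison spends on each rate.\<close>
  have g: "?g \<ge> Wm" using assms by simp
  obtain lam where lam: "0 \<le> lam" "lam \<le> 1" and R: "R1 \<le> Cap Wm ?snr1" "R2 \<le> Cap Wm ((1 - lam) * ?snr2)"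
    "R1 + R2 \<le> sum_rate_outer Wm W ?snr1 ?snr2 ?inr ?snrs lam"
    using capacity_region_outer_bound[OF assms(1-5,7)] by blast
  consider (weak) "?inr \<le> ?snr2" | (strong) "?snr2 < ?inr" "?inr \<le> ?snr2 * (1 + ?snr1)"
    | (very_strong) "?snr2 < ?inr" "?snr2 * (1 + ?snr1) < ?inr"
    by linarith
  then show ?thesis
  proof cases
    case weak
    then show ?thesis
      by (intro weak_interference_gap[OF assms(4,5) nonneg(1,3,4) _ lam R g])
  next
    case strong
    let ?a = "(1 - lam) * ?inr" and ?s = "(1 - lam) * ?snr2"
    have as: "0 \<le> ?s" "?s \<le> ?a"
      using lam nonneg strong by (auto intro!: mult_left_mono mult_nonneg_nonneg simp del: times_divide_eq_right)
    have "Cap Wm (2 * ?snr1 + 2 * ?a) \<le> Cap Wm (?snr1 + ?a) + Wm"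
      using assms as nonneg by (intro Cap_le_plus) (auto simp del: times_divide_eq_right)
    \<comment> \<open>Since INR exceeds SNR2, the ratio is at most 1 and the whole Y2 term is worth
      one bit; the other bit of the sum has paid for the doubling.\<close>
    moreover have "Cap Wm (?s / (1 + ?a)) \<le> Cap Wm 0 + Wm"
      using as by (intro Cap_le_plus assms) (auto simp: divide_le_eq simp del: times_divide_eq_right)
    ultimately have "(R1 - ?g) + (R2 - ?g) \<le> Cap Wm (?snr1 + ?a) + WCap Wm W (lam * ?snrs)"
      using R(3) g unfolding sum_rate_outer_def by (simp del: times_divide_eq_right)
    moreover have "R1 - ?g \<le> Cap Wm ?snr1" "R2 - ?g \<le> Cap Wm ?s"
      using R g assms(4) by linarith+
    ultimately show ?thesis
      using strong lam unfolding R_BC_def by (auto intro!: bexI[of _ lam] simp del: times_divide_eq_right)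
  next
    case very_strong
    \<comment> \<open>No sum constraint is present in this regime, so it suffices to enlarge the
      \<open>R2\<close> bound to full main-channel power.\<close>
    have "(1 - lam) * ?snr2 \<le> 1 * ?snr2"
      using lam nonneg by (intro mult_right_mono) auto
    then have "Cap Wm ((1 - lam) * ?snr2) \<le> Cap Wm ?snr2"
      using lam nonneg assms by (intro Cap_mono) (auto simp del: times_divide_eq_right)
    then have "R1 - ?g \<le> Cap Wm ?snr1" "R2 - ?g \<le> Cap Wm ?snr2"
      using R g assms(4) by linarith+
    then show ?thesis
      using very_strong unfolding R_BC_def by simp
  qed
qed

end
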